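(* Let $a,c>0$, $\beta:=a/c$, and $r_t(x):=\sqrt{c^2t^2-x^2}$ for $|x|\le ct$. For $t>0$ let $\mu_t$ be the probability measure on $\mathbb{R}$ given for Borel sets $A\subset\mathbb{R}$ by $$\mu_t(A)=\frac{e^{-at}}{2}\big(\delta_{-ct}(A)+\delta_{ct}(A)\big)+\int_A \tilde u(t,x)\,\mathrm{d}x,$$ $$\tilde u(t,x)=\frac12 e^{-at}\Big(\beta ct\,\frac{I_0'(\beta r_t(x))}{r_t(x)}+\beta I_0(\beta r_t(x))\Big)1_{[-ct,ct]}(x),$$ which is the distribution at time $t$ of the one-dimensional Kac process with parameters $(a,c)$ starting in $0$ (so $\mu_0=\delta_0$). Then $\mu_t$ solves the continuity equation $$\partial_t\mu_t=-\partial_x(\mu_t v_t)$$ in the weak sense, where the velocity field $v_t(x)=v(t,x)$ is given by $$v(t,x)=\begin{cases}\dfrac{x}{t+\frac{r_t(x)}{c}\frac{I_0(\beta r_t(x))}{I_0'(\beta r_t(x))}} & \text{if } x\in(-ct,ct),\\[2mm] c & \text{if } x=ct,\\ -c & \text{if } x=-ct,\\ \text{arbitrary} & \text{otherwise.}\end{cases}$$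
   Context: $I_0$ denotes the modified Bessel function of the first kind of order $0$, and $I_0'=I_1$ its derivative. $\delta_y$ is the Dirac measure at $y$. The one-dimensional Kac process starting in $0$ with parameters $a>0$ (damping) and $c>0$ (velocity) is $K(t)=B\,c\int_0^t(-1)^{N(s)}\,\mathrm{d}s$, where $(N(s))_{s\ge0}$ is a homogeneous Poisson process with rate $a$ and $B$ is an independent random variable taking the values $\pm1$ with probability $\tfrac12$ each. The continuity equation holds in the weak (distributional) sense if $\int_0^\infty\int_{\mathbb{R}}\big(\partial_t\psi(t,x)+v(t,x)\,\partial_x\psi(t,x)\big)\,\mathrm{d}\mu_t(x)\,\mathrm{d}t=0$ for all $\psi\in C_c^\infty((0,\infty)\times\mathbb{R})$. "Arbitrary" means any values making $v$ Borel measurable (the set in question is $\mu_t$-null). *)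

theory Defs
  imports "HOL-Probability.Probability"
begin

definition bessel_I :: "nat \<Rightarrow> real \<Rightarrow> real" where
  "bessel_I n z = (\<Sum>k. (z / 2) ^ (2 * k + n) / (fact k * fact (k + n)))"

abbreviation bessel_I0 :: "real \<Rightarrow> real" where
  "bessel_I0 \<equiv> bessel_I 0"

abbreviation bessel_I0' :: "real \<Rightarrow> real" where
  "bessel_I0' \<equiv> deriv bessel_I0"

lemma borel_measurable_bessel_I [measurable]: "bessel_I n \<in> borel_measurable borel"
  unfolding bessel_I_def [abs_def] by measurable

lemma summable_bessel_I0_aux: "summable (\<lambda>k. inverse (fact k ^ 2) * (y :: real) ^ k)"
proof (rule summable_comparison_test)
  show "summable (\<lambda>k. inverse (fact k) * \<bar>y\<bar> ^ k :: real)"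
    using summable_exp [of "\<bar>y\<bar>"] by (simp add: field_simps)
  have "norm (inverse (fact k ^ 2) * y ^ k) \<le> inverse (fact k) * \<bar>y\<bar> ^ k" for k
  proof -
    have "(fact k :: real) * 1 \<le> fact k * fact k"
      by (intro mult_left_mono fact_ge_1) auto
    then have "inverse (fact k ^ 2 :: real) \<le> inverse (fact k)"
      by (intro le_imp_inverse_le) (auto simp: power2_eq_square)
    then have "inverse (fact k ^ 2) * \<bar>y\<bar> ^ k \<le> inverse (fact k) * \<bar>y\<bar> ^ k"
      by (rule mult_right_mono) simp
    then show ?thesis
      by (simp only: real_norm_def abs_mult power_abs abs_inverse) simp
  qed
  then show "\<exists>N. \<forall>k\<ge>N. norm (inverse (fact k ^ 2) * y ^ k) \<le> inverse (fact k) * \<bar>y\<bar> ^ k"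
    by blast
qed

lemma has_field_derivative_bessel_I0:
  "(bessel_I0 has_field_derivative bessel_I 1 z) (at z)"
proof -
  define h :: "real \<Rightarrow> real" where "h y = (\<Sum>k. inverse (fact k ^ 2) * y ^ k)" for y
  define d :: "nat \<Rightarrow> real" where "d = diffs (\<lambda>k. inverse (fact k ^ 2))"
  have h': "(h has_field_derivative (\<Sum>k. d k * y ^ k)) (at y)" for y
    unfolding h_def [abs_def] d_def
    by (rule termdiffs_strong_converges_everywhere) (rule summable_bessel_I0_aux)
  have summ: "summable (\<lambda>k. d k * y ^ k)" for y
    unfolding d_def by (rule termdiff_converges_all) (rule summable_bessel_I0_aux)
  have pow: "(z / 2) ^ (2 * k) = (z ^ 2 / 4) ^ k" for k and z :: real
    unfolding power_mult by (simp add: power_divide)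
  have aux: "x / (y * y) = inverse (y ^ 2) * x" for x y :: real
    by (simp only: divide_inverse power2_eq_square mult.commute)
  have "(z / 2) ^ (2 * k + 0) / (fact k * fact (k + 0)) = inverse (fact k ^ 2) * (z ^ 2 / 4) ^ k"
    for k and z :: real
    unfolding add_0_right pow by (rule aux)
  then have eq: "bessel_I0 = (\<lambda>z. h (z ^ 2 / 4))"
    unfolding fun_eq_iff bessel_I_def h_def by simp
  have dk: "d k = 1 / (fact k * fact (k + 1))" for k
  proof -
    have "x * inverse ((x * f) ^ 2) = 1 / (f * (x * f))" if "x > 0" "f > 0" for x f :: real
      using that by (simp add: power2_eq_square divide_simps)
    from this [of "1 + real k" "fact k"] show ?thesis
      by (simp add: d_def diffs_def)
  qed
  have "bessel_I 1 z = (\<Sum>k. (d k * (z ^ 2 / 4) ^ k) * (z / 2))"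
    unfolding bessel_I_def dk power_add pow by (simp add: mult.commute [of 2])
  also have "\<dots> = (\<Sum>k. d k * (z ^ 2 / 4) ^ k) * (z / 2)"
    by (rule suminf_mult2 [symmetric]) (rule summ)
  finally have val: "bessel_I 1 z = (\<Sum>k. d k * (z ^ 2 / 4) ^ k) * (z / 2)" .
  have "((\<lambda>z. z ^ 2 / 4) has_field_derivative z / 2) (at z)"
    by (auto intro!: derivative_eq_intros)
  from DERIV_chain2 [OF h' this] show ?thesis
    unfolding eq val .
qed

lemma bessel_I0'_eq: "bessel_I0' = bessel_I 1"
  using has_field_derivative_bessel_I0 by (auto intro!: DERIV_imp_deriv)

definition kac_radius :: "real \<Rightarrow> real \<Rightarrow> real \<Rightarrow> real" where
  "kac_radius c t x = sqrt (c\<^sup>2 * t\<^sup>2 - x\<^sup>2)"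

text \<open>At \<open>x = \<plusminus>c t\<close> the quotient is \<open>0 / 0 = 0\<close>; this affects only a Lebesgue null set.\<close>

definition kac_density :: "real \<Rightarrow> real \<Rightarrow> real \<Rightarrow> real \<Rightarrow> real" where
  "kac_density a c t x =
     (let \<beta> = a / c; r = kac_radius c t x in
       1 / 2 * exp (- a * t) *
       (\<beta> * c * t * (bessel_I0' (\<beta> * r) / r) + \<beta> * bessel_I0 (\<beta> * r)) *
       indicator {- c * t..c * t} x)"

definition kac_law :: "real \<Rightarrow> real \<Rightarrow> real \<Rightarrow> real measure" where
  "kac_law a c t = measure_of UNIV (sets borel) (\<lambda>A.
     ennreal (exp (- a * t) / 2) *
       (emeasure (return borel (- c * t)) A + emeasure (return borel (c * t)) A) +
     (\<integral>\<^sup>+x\<in>A. ennreal (kac_density a c t x) \<partial>lborel))"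

lemma borel_measurable_kac_density [measurable]: "kac_density a c t \<in> borel_measurable borel"
  unfolding kac_density_def [abs_def] kac_radius_def Let_def bessel_I0'_eq by measurable

lemma sets_kac_law [simp, measurable_cong]: "sets (kac_law a c t) = sets borel"
  unfolding kac_law_def using sets.sigma_sets_eq [of "borel :: real measure"] by simp

lemma emeasure_kac_law:
  assumes "A \<in> sets borel"
  shows "emeasure (kac_law a c t) A =
     ennreal (exp (- a * t) / 2) *
       (emeasure (return borel (- c * t)) A + emeasure (return borel (c * t)) A) +
     (\<integral>\<^sup>+x\<in>A. ennreal (kac_density a c t x) \<partial>lborel)"
    (is "_ = ?m A")
proof (rule emeasure_measure_of [OF kac_law_def])
  have dens: "(\<integral>\<^sup>+x\<in>A. ennreal (kac_density a c t x) \<partial>lborel) =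
      emeasure (density lborel (\<lambda>x. ennreal (kac_density a c t x))) A" if "A \<in> sets borel" for A
    using that by (subst emeasure_density) auto
  show "positive (sets (kac_law a c t)) ?m"
    by (simp add: positive_def)
  show "countably_additive (sets (kac_law a c t)) ?m"
  proof (rule countably_additiveI)
    fix F :: "nat \<Rightarrow> real set"
    assume F: "range F \<subseteq> sets (kac_law a c t)" "disjoint_family F"
    then have rF: "range F \<subseteq> sets borel" and Fi: "\<And>i. F i \<in> sets borel"
      by auto
    let ?c = "ennreal (exp (- a * t) / 2)"
    let ?D1 = "return borel (- c * t)" and ?D2 = "return borel (c * t)"
    let ?D3 = "density lborel (\<lambda>x. ennreal (kac_density a c t x))"
    have eq: "?m A = ?c * (emeasure ?D1 A + emeasure ?D2 A) + emeasure ?D3 A" if "A \<in> sets borel" for A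
      by (simp only: dens [OF that])
    have s: "(\<Sum>i. emeasure M (F i)) = emeasure M (\<Union> (range F))" if "sets M = sets borel" for M
      using rF F(2) that by (intro suminf_emeasure) auto
    have "(\<Sum>i. ?m (F i)) =
        (\<Sum>i. ?c * (emeasure ?D1 (F i) + emeasure ?D2 (F i)) + emeasure ?D3 (F i))"
      by (intro suminf_cong eq Fi)
    also have "\<dots> = (\<Sum>i. ?c * (emeasure ?D1 (F i) + emeasure ?D2 (F i))) + (\<Sum>i. emeasure ?D3 (F i))"
      by (rule suminf_add [symmetric]) (rule summableI)+
    also have "(\<Sum>i. ?c * (emeasure ?D1 (F i) + emeasure ?D2 (F i))) =
        ?c * (\<Sum>i. emeasure ?D1 (F i) + emeasure ?D2 (F i))"
      by (rule ennreal_suminf_cmult)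
    also have "(\<Sum>i. emeasure ?D1 (F i) + emeasure ?D2 (F i)) =
        (\<Sum>i. emeasure ?D1 (F i)) + (\<Sum>i. emeasure ?D2 (F i))"
      by (rule suminf_add [symmetric]) (rule summableI)+
    also have "?c * ((\<Sum>i. emeasure ?D1 (F i)) + (\<Sum>i. emeasure ?D2 (F i))) + (\<Sum>i. emeasure ?D3 (F i)) =
        ?c * (emeasure ?D1 (\<Union> (range F)) + emeasure ?D2 (\<Union> (range F))) + emeasure ?D3 (\<Union> (range F))"
      by (simp only: s sets_return sets_density sets_lborel)
    also have "\<dots> = ?m (\<Union> (range F))"
      using rF by (intro eq [symmetric] sets.countable_UN)
    finally show "(\<Sum>i. ?m (F i)) = ?m (\<Union> (range F))" .
  qed
qed (use assms in auto)

text \<open>``Arbitrary otherwise'': nothing is required outside \<open>[-c t, c t]\<close> beyond Borel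
  measurability of \<open>v\<close> on \<open>(0,\<infinity>) \<times> \<real>\<close>.\<close>

definition kac_velocity :: "real \<Rightarrow> real \<Rightarrow> (real \<Rightarrow> real \<Rightarrow> real) \<Rightarrow> bool" where
  "kac_velocity a c v \<longleftrightarrow>
     (\<lambda>(t, x). v t x) \<in> borel_measurable (restrict_space borel ({0<..} \<times> UNIV)) \<and>
     (\<forall>t>0.
        (\<forall>x\<in>{- c * t<..<c * t}.
           let \<beta> = a / c; r = kac_radius c t x in
           v t x = x / (t + r / c * (bessel_I0 (\<beta> * r) / bessel_I0' (\<beta> * r)))) \<and>
        v t (c * t) = c \<and>
        v t (- c * t) = - c)"

definition poisson_process :: "'w measure \<Rightarrow> real \<Rightarrow> (real \<Rightarrow> 'w \<Rightarrow> nat) \<Rightarrow> bool" where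
  "poisson_process M a N \<longleftrightarrow>
     prob_space M \<and>
     (\<forall>t\<ge>0. N t \<in> M \<rightarrow>\<^sub>M count_space UNIV) \<and>
     (\<forall>\<omega>\<in>space M. N 0 \<omega> = 0 \<and> mono_on {0..} (\<lambda>t. N t \<omega>) \<and>
        (\<forall>t\<ge>0. continuous (at_right t) (\<lambda>s. N s \<omega>))) \<and>
     (\<forall>s t. 0 \<le> s \<and> s < t \<longrightarrow>
        distr M (count_space UNIV) (\<lambda>\<omega>. N t \<omega> - N s \<omega>) = measure_pmf (poisson_pmf (a * (t - s)))) \<and>
     (\<forall>n (\<tau> :: nat \<Rightarrow> real). 0 \<le> \<tau> 0 \<and> (\<forall>i<n. \<tau> i < \<tau> (Suc i)) \<longrightarrow>
        prob_space.indep_vars M (\<lambda>_. count_space UNIV)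
          (\<lambda>i \<omega>. N (\<tau> (Suc i)) \<omega> - N (\<tau> i) \<omega>) {..<n})"

definition kac_driver ::
    "'w measure \<Rightarrow> real \<Rightarrow> (real \<Rightarrow> 'w \<Rightarrow> nat) \<Rightarrow> ('w \<Rightarrow> real) \<Rightarrow> bool" where
  "kac_driver M a N B \<longleftrightarrow>
     poisson_process M a N \<and>
     B \<in> borel_measurable M \<and>
     (\<forall>\<omega>\<in>space M. B \<omega> \<in> {-1, 1}) \<and>
     measure M {\<omega> \<in> space M. B \<omega> = 1} = 1 / 2 \<and>
     measure M {\<omega> \<in> space M. B \<omega> = -1} = 1 / 2 \<and>
     prob_space.indep_set M
       (sets (vimage_algebra (space M) B borel))
       (sets (vimage_algebra (space M) (\<lambda>\<omega>. \<lambda>t\<in>{0..}. N t \<omega>)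
          (PiM {0..} (\<lambda>_. count_space UNIV))))"

definition kac_process ::
    "real \<Rightarrow> (real \<Rightarrow> 'w \<Rightarrow> nat) \<Rightarrow> ('w \<Rightarrow> real) \<Rightarrow> real \<Rightarrow> 'w \<Rightarrow> real" where
  "kac_process c N B t \<omega> = B \<omega> * c * (LINT s:{0..t}|lborel. (-1) ^ N s \<omega>)"

primrec Ck :: "nat \<Rightarrow> ('a :: euclidean_space \<Rightarrow> real) \<Rightarrow> bool" where
  "Ck 0 f \<longleftrightarrow> continuous_on UNIV f"
| "Ck (Suc k) f \<longleftrightarrow> (\<forall>x. f differentiable at x) \<and>
     (\<forall>b\<in>Basis. Ck k (\<lambda>x. frechet_derivative f (at x) b))"

text \<open>Elements of \<open>C\<^sub>c\<^sup>\<infinity>((0,\<infinity>) \<times> \<real>)\<close>, extended by zero to \<open>\<real> \<times> \<real>\<close>.\<close>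

definition test_function :: "(real \<times> real \<Rightarrow> real) \<Rightarrow> bool" where
  "test_function \<psi> \<longleftrightarrow>
     (\<forall>k. Ck k \<psi>) \<and>
     compact (closure {p. \<psi> p \<noteq> 0}) \<and>
     closure {p. \<psi> p \<noteq> 0} \<subseteq> {0<..} \<times> UNIV"

definition continuity_integrand ::
    "(real \<Rightarrow> real \<Rightarrow> real) \<Rightarrow> (real \<times> real \<Rightarrow> real) \<Rightarrow> real \<Rightarrow> real \<Rightarrow> real" where
  "continuity_integrand v \<psi> t x =
     deriv (\<lambda>s. \<psi> (s, x)) t + v t x * deriv (\<lambda>y. \<psi> (t, y)) x"

text \<open>The Bochner integral of a non-integrable function is \<open>0\<close> by convention, so integrability
  is required explicitly.\<close>

definition weak_continuity_solution ::
    "(real \<Rightarrow> real measure) \<Rightarrow> (real \<Rightarrow> real \<Rightarrow> real) \<Rightarrow> bool" where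
  "weak_continuity_solution \<mu> v \<longleftrightarrow>
     (\<forall>\<psi>. test_function \<psi> \<longrightarrow>
        (\<forall>t>0. integrable (\<mu> t) (continuity_integrand v \<psi> t)) \<and>
        set_integrable lborel {0<..} (\<lambda>t. LINT x|\<mu> t. continuity_integrand v \<psi> t x) \<and>
        (LINT t:{0<..}|lborel. (LINT x|\<mu> t. continuity_integrand v \<psi> t x)) = 0)"

end

theory Submission
  imports Defs
begin

text \<open>
  Write \<open>b = a / c\<close>. The density \<open>p\<close> of the absolutely continuous part and the flux \<open>q = v p\<close>
  both extend to smooth functions on the plane, expressed through the entire functions
  \<open>h\<^sub>n y = (\<Sum>k. y ^ k / (k! (k + n)!))\<close> at \<open>y = b\<^sup>2 (c\<^sup>2 t\<^sup>2 - x\<^sup>2) / 4\<close>. The equation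
  \<open>y h\<^sub>2 + h\<^sub>1 = h\<^sub>0\<close> turns into the telegraph system \<open>p\<^sub>t = - q\<^sub>x\<close>, \<open>q\<^sub>t = - c\<^sup>2 p\<^sub>x - 2 a q\<close>,
  and the boundary values of \<open>p\<close> and \<open>q\<close> on the cone compensate the decay of the two atoms. Hence
  \<open>d/dt \<integral> f d\<mu>\<^sub>t = \<integral> (f\<^sub>t + v f\<^sub>x) d\<mu>\<^sub>t\<close> for every \<open>C\<^sup>1\<close> function \<open>f\<close>, which yields the continuity
  equation for test functions and conservation of mass for \<open>f = 1\<close>.

  For the law of the process, \<open>A = \<integral> cos (k x) d\<mu>\<^sub>t\<close> and \<open>D = \<integral> v sin (k x) d\<mu>\<^sub>t\<close> satisfy
  \<open>A' = - k D\<close>, \<open>D' = c\<^sup>2 k A - 2 a D\<close>. The corresponding expectations along the Kac process satisfy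
  the same system, by the chain rule along a path, Fubini, and the independence of the parity of
  \<open>N t - N s\<close> from the path up to time \<open>s\<close>. The difference of two solutions has nonincreasing
  energy \<open>c\<^sup>2 A\<^sup>2 + D\<^sup>2\<close>, so the characteristic functions agree.
\<close>

section \<open>The entire functions behind the Bessel functions\<close>

text \<open>For \<open>y > 0\<close> this is
  \<open>y powr (- n / 2) * bessel_I n (2 * sqrt y)\<close>. Working in \<open>y\<close> removes the
  square root in \<open>kac_radius\<close>, so the function is smooth across the boundary
  \<open>y = 0\<close> of the cone and stays defined for \<open>y < 0\<close>, outside it.\<close>

definition bessel_gen :: "nat \<Rightarrow> real \<Rightarrow> real" where
  "bessel_gen n y = (\<Sum>k. y ^ k / (fact k * fact (k + n)))"

lemma summable_bessel_gen: "summable (\<lambda>k. y ^ k / (fact k * fact (k + n)) :: real)"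
proof (rule summable_comparison_test)
  show "summable (\<lambda>k. inverse (fact k) * \<bar>y\<bar> ^ k :: real)"
    using summable_exp [of "\<bar>y\<bar>"] by (simp add: field_simps)
  have "norm (y ^ k / (fact k * fact (k + n))) \<le> inverse (fact k) * \<bar>y\<bar> ^ k" for k
  proof -
    have "\<bar>y\<bar> ^ k / fact k * (1 / fact (k + n)) \<le> \<bar>y\<bar> ^ k / fact k * 1"
      by (intro mult_left_mono) auto
    then show ?thesis
      by (simp add: power_abs abs_mult field_simps)
  qed
  then show "\<exists>N. \<forall>k\<ge>N. norm (y ^ k / (fact k * fact (k + n))) \<le> inverse (fact k) * \<bar>y\<bar> ^ k"
    by blast
qed

text \<open>Termwise differentiation cancels one factor of \<open>fact k\<close>; after reindexing,
  the shift reappears in the other factorial.\<close>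

lemma has_field_derivative_bessel_gen:
  "(bessel_gen n has_field_derivative bessel_gen (Suc n) y) (at y)"
proof -
  have *: "summable (\<lambda>k. (1 / (fact k * fact (k + n))) * y ^ k :: real)" for y
    using summable_bessel_gen [of y n] by simp
  have d: "diffs (\<lambda>k. 1 / (fact k * fact (k + n)) :: real) k = 1 / (fact k * fact (k + Suc n))" for k
    by (simp add: diffs_def divide_simps)
  show ?thesis
    using termdiffs_strong_converges_everywhere [OF *, of y]
    unfolding d bessel_gen_def [abs_def] by simp
qed

lemma bessel_gen_zero [simp]: "bessel_gen n 0 = 1 / fact n"
  unfolding bessel_gen_def by (subst suminf_finite [of "{0}"]) auto

text \<open>In terms of \<open>y = z^2 / 4\<close> this is the Bessel recurrence I_0(z) - I_2(z) =
  (2 / z) I_1(z). It is checked coefficientwise; splitting off the constant terms 1 of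
  \<open>bessel_gen 1\<close> and \<open>bessel_gen 0\<close> aligns the three series.\<close>

lemma bessel_gen_ode: "y * bessel_gen 2 y + bessel_gen 1 y = bessel_gen 0 y"
proof -
  let ?s = "\<lambda>k. y ^ Suc k / (fact k * fact (k + 2)) + y ^ Suc k / (fact (Suc k) * fact (Suc k + 1))"
  have 2: "(\<lambda>k. y * (y ^ k / (fact k * fact (k + 2)))) sums (y * bessel_gen 2 y)"
    unfolding bessel_gen_def by (intro sums_mult summable_sums summable_bessel_gen)
  have 1: "(\<lambda>k. y ^ Suc k / (fact (Suc k) * fact (Suc k + 1))) sums (bessel_gen 1 y - 1)"
    using summable_sums [OF summable_bessel_gen [of y 1]]
    by (subst sums_Suc_iff) (simp add: bessel_gen_def)
  have 0: "(\<lambda>k. y ^ Suc k / (fact (Suc k) * fact (Suc k + 0))) sums (bessel_gen 0 y - 1)"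
    using summable_sums [OF summable_bessel_gen [of y 0]]
    by (subst sums_Suc_iff) (simp add: bessel_gen_def)
  have "y * (y ^ k / (fact k * fact (k + 2))) + y ^ Suc k / (fact (Suc k) * fact (Suc k + 1)) =
      y ^ Suc k / (fact (Suc k) * fact (Suc k + 0))" for k
  proof -
    have "y * (z / (f * ((2 + k) * ((1 + k) * f)))) + y * z / ((1 + k) * f * ((2 + k) * ((1 + k) * f))) =
        y * z / ((1 + k) * f * ((1 + k) * f))" if "f > 0" "k \<ge> 0" for f k z :: real
      using that by (simp add: divide_simps) (simp add: algebra_simps)
    from this [of "fact k" "real k" "y ^ k"] show ?thesis
      by (simp add: numeral_2_eq_2)
  qed
  with sums_add [OF 2 1] have "(\<lambda>k. y ^ Suc k / (fact (Suc k) * fact (Suc k + 0))) sums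
      (y * bessel_gen 2 y + (bessel_gen 1 y - 1))"
    by simp
  from sums_unique2 [OF this 0] show ?thesis
    by simp
qed

lemma bessel_I_eq_gen: "bessel_I n z = (z / 2) ^ n * bessel_gen n (z\<^sup>2 / 4)"
proof -
  have pow: "(z / 2) ^ (2 * k + n) = (z / 2) ^ n * (z\<^sup>2 / 4) ^ k" for k
    unfolding power_add power_mult by (simp add: power_divide mult.commute)
  have "bessel_I n z = (\<Sum>k. (z / 2) ^ n * ((z\<^sup>2 / 4) ^ k / (fact k * fact (k + n))))"
    unfolding bessel_I_def
    by (simp add: pow)
  also have "\<dots> = (z / 2) ^ n * bessel_gen n (z\<^sup>2 / 4)"
    unfolding bessel_gen_def by (intro suminf_mult summable_bessel_gen)
  finally show ?thesis .
qed

text \<open>Used for the nonnegativity of the density and to keep the denominator of the velocity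
  away from zero inside the cone.\<close>

lemma bessel_gen_pos: "bessel_gen n y > 0" if "y \<ge> 0"
  unfolding bessel_gen_def
  by (rule suminf_pos2 [OF summable_bessel_gen, where i = 0]) (use that in auto)

lemmas [derivative_intros] =
  has_field_derivative_bessel_gen [THEN DERIV_chain2]
  has_field_derivative_bessel_gen [THEN DERIV_compose_FDERIV]

lemma continuous_on_bessel_gen [continuous_intros]:
  "continuous_on S f \<Longrightarrow> continuous_on S (\<lambda>x. bessel_gen n (f x))"
  by (rule continuous_on_compose2 [OF DERIV_continuous_on
        [OF has_field_derivative_at_within [OF has_field_derivative_bessel_gen]]]) auto

section \<open>Balance laws on the light cone\<close>

definition C1_with ::
    "(real \<Rightarrow> real \<Rightarrow> real) \<Rightarrow> (real \<Rightarrow> real \<Rightarrow> real) \<Rightarrow> (real \<Rightarrow> real \<Rightarrow> real) \<Rightarrow> bool" where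
  "C1_with f ft fx \<longleftrightarrow>
     (\<forall>t x. ((\<lambda>z. f (fst z) (snd z)) has_derivative (\<lambda>h. ft t x * fst h + fx t x * snd h)) (at (t, x))) \<and>
     continuous_on UNIV (\<lambda>z. ft (fst z) (snd z)) \<and>
     continuous_on UNIV (\<lambda>z. fx (fst z) (snd z))"

text \<open>Chain rule along a curve. The value of the derivative is a free \<open>e\<close>, so
  that the rule can be chained with \<open>derivative_eq_intros\<close>.\<close>

lemma C1_with_DERIV:
  assumes f: "C1_with f ft fx"
    and p: "(p has_real_derivative p') (at s)"
    and q: "(q has_real_derivative q') (at s)"
    and e: "e = ft (p s) (q s) * p' + fx (p s) (q s) * q'"
  shows "((\<lambda>s. f (p s) (q s)) has_real_derivative e) (at s)"
proof -
  have "((\<lambda>s. (p s, q s)) has_derivative (\<lambda>h. (p' * h, q' * h))) (at s)"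
    using p q by (intro has_derivative_Pair) (auto simp: has_field_derivative_def)
  moreover have "((\<lambda>z. f (fst z) (snd z)) has_derivative
      (\<lambda>h. ft (p s) (q s) * fst h + fx (p s) (q s) * snd h)) (at (p s, q s))"
    using f by (simp add: C1_with_def)
  ultimately have "((\<lambda>s. f (fst (p s, q s)) (snd (p s, q s))) has_derivative
      (\<lambda>h. ft (p s) (q s) * fst (p' * h, q' * h) + fx (p s) (q s) * snd (p' * h, q' * h))) (at s)"
    by (rule has_derivative_compose)
  moreover have "(\<lambda>h. ft (p s) (q s) * fst (p' * h, q' * h) + fx (p s) (q s) * snd (p' * h, q' * h)) = (*) e"
    by (simp add: e fun_eq_iff algebra_simps)
  ultimately show ?thesis
    by (simp add: has_field_derivative_def)
qed

lemma continuous_on_uncurried: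
  assumes "continuous_on UNIV (\<lambda>z. f (fst z) (snd z) :: real)"
    and "continuous_on S p" "continuous_on S q"
  shows "continuous_on S (\<lambda>s. f (p s) (q s))"
  using continuous_on_compose2 [OF assms(1) continuous_on_Pair [OF assms(2,3)]] by simp

lemma C1_with_continuous:
  assumes "C1_with f ft fx" "continuous_on S p" "continuous_on S q"
  shows "continuous_on S (\<lambda>s. f (p s) (q s))" "continuous_on S (\<lambda>s. ft (p s) (q s))"
    "continuous_on S (\<lambda>s. fx (p s) (q s))"
proof -
  have "continuous_on UNIV (\<lambda>z. f (fst z) (snd z))"
    unfolding continuous_on_eq_continuous_at [OF open_UNIV]
  proof
    fix z :: "real \<times> real"
    show "continuous (at z) (\<lambda>z. f (fst z) (snd z))"
      using assms(1) unfolding C1_with_def by (cases z) (blast intro: has_derivative_continuous)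
  qed
  then show "continuous_on S (\<lambda>s. f (p s) (q s))" "continuous_on S (\<lambda>s. ft (p s) (q s))"
    "continuous_on S (\<lambda>s. fx (p s) (q s))"
    using assms(1) unfolding C1_with_def
    by (rule_tac continuous_on_uncurried [OF _ assms(2,3)]; simp)+
qed

text \<open>Rescaling to the fixed interval \<open>[-1, 1]\<close> reduces the moving cone to differentiation under the
  integral sign. The fluxes \<open>c u \<mp> w\<close> through the boundary come from integrating the primitive
  \<open>(c y u - w) f\<close> over \<open>y\<close>.\<close>

lemma has_real_derivative_balance_law:
  fixes c \<kappa> t :: real
  assumes f: "C1_with f ft fx" and u: "C1_with u ut ux" and w: "C1_with w wt wx"
    and bal: "\<And>t x. ut t x + wx t x = \<kappa> * u t x"
  shows "((\<lambda>t. c * t * integral {-1..1} (\<lambda>y. u t (c * t * y) * f t (c * t * y))) has_real_derivative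
      c * t * integral {-1..1} (\<lambda>y. u t (c * t * y) * ft t (c * t * y) + w t (c * t * y) * fx t (c * t * y)
         + \<kappa> * (u t (c * t * y) * f t (c * t * y)))
      + (c * u t (c * t) - w t (c * t)) * f t (c * t)
      + (c * u t (- c * t) + w t (- c * t)) * f t (- c * t)) (at t)"
proof -
  note cont = f [THEN C1_with_continuous(1)] f [THEN C1_with_continuous(2)] f [THEN C1_with_continuous(3)]
    u [THEN C1_with_continuous(1)] u [THEN C1_with_continuous(2)] u [THEN C1_with_continuous(3)]
    w [THEN C1_with_continuous(1)] w [THEN C1_with_continuous(2)] w [THEN C1_with_continuous(3)]
  define H where "H t y = c * t * (u t (c * t * y) * f t (c * t * y))" for t y
  define H' where "H' t y = c * (u t (c * t * y) * f t (c * t * y)) +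
     c * t * ((ut t (c * t * y) + ux t (c * t * y) * (c * y)) * f t (c * t * y) +
        u t (c * t * y) * (ft t (c * t * y) + fx t (c * t * y) * (c * y)))" for t y
  define E where "E y = u t (c * t * y) * ft t (c * t * y) + w t (c * t * y) * fx t (c * t * y)
         + \<kappa> * (u t (c * t * y) * f t (c * t * y))" for y
  define K where "K y = (c * y * u t (c * t * y) - w t (c * t * y)) * f t (c * t * y)" for y
  have dH: "((\<lambda>t. H t y) has_real_derivative H' t y) (at t)" for t y
    unfolding H_def H'_def
    by (rule derivative_eq_intros C1_with_DERIV [OF f] C1_with_DERIV [OF u] refl)+
      (simp add: algebra_simps)
  have leib: "((\<lambda>t. integral (cbox (-1) 1) (H t)) has_real_derivative integral (cbox (-1) 1) (H' t)) (at t within UNIV)"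
  proof (rule leibniz_rule_field_derivative)
    show "H t integrable_on cbox (- 1) 1" for t
      unfolding H_def by (intro integrable_continuous continuous_intros cont)
    show "continuous_on (UNIV \<times> cbox (- 1) 1) (\<lambda>(x, y). H' x y)"
      unfolding H'_def case_prod_beta by (intro continuous_intros cont)
  qed (use dH in auto)
  \<comment> \<open>The balance law replaces \<open>ut\<close> by \<open>\<kappa> * u - wx\<close>;
    what is left of \<open>H' t y - c * t * E y\<close> is an exact derivative in
    \<open>y\<close>.\<close>
  have "(K has_real_derivative (H' t y - c * t * E y)) (at y)" for y
  proof -
    have *: "(c * y * ux t (c * t * y) * (c * t) + c * u t (c * t * y) - wx t (c * t * y) * (c * t)) * f t (c * t * y)
        + (c * y * u t (c * t * y) - w t (c * t * y)) * (fx t (c * t * y) * (c * t)) = H' t y - c * t * E y"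
    proof -
      have ut: "ut t (c * t * y) = \<kappa> * u t (c * t * y) - wx t (c * t * y)"
        using bal [of t "c * t * y"] by simp
      show ?thesis
        unfolding E_def H'_def ut by (simp add: algebra_simps)
    qed
    show ?thesis
      unfolding K_def [abs_def] * [symmetric]
      by (rule DERIV_cong,
          (rule derivative_intros C1_with_DERIV [OF f] C1_with_DERIV [OF u] C1_with_DERIV [OF w] refl)+)
        (simp add: algebra_simps)
  qed
  then have iD: "((\<lambda>y. H' t y - c * t * E y) has_integral (K 1 - K (-1))) {-1..1}"
    by (intro fundamental_theorem_of_calculus)
      (auto simp: has_real_derivative_iff_has_vector_derivative [symmetric] has_field_derivative_at_within)
  have iE: "(\<lambda>y. c * t * E y) integrable_on {-1..1}"
    unfolding E_def by (intro integrable_continuous_interval continuous_intros cont)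
  \<comment> \<open>\<open>K 1\<close> and \<open>- K (-1)\<close> are the boundary fluxes at
    \<open>x = c * t\<close> and \<open>x = - c * t\<close>.\<close>
  have "integral {-1..1} (H' t) = c * t * integral {-1..1} E + (K 1 - K (-1))"
    using has_integral_add [OF iD integrable_integral [OF iE]] by (simp add: integral_unique)
  with leib show ?thesis
    unfolding H_def [abs_def] E_def [abs_def] K_def by (simp add: algebra_simps)
qed

section \<open>The telegraph system\<close>

text \<open>Inside the cone this is \<open>(b * kac_radius c t x)^2 / 4\<close>, written as a
  polynomial so that it is smooth on the whole plane.\<close>

definition bessel_arg :: "real \<Rightarrow> real \<Rightarrow> real \<Rightarrow> real \<Rightarrow> real" where
  "bessel_arg b c t x = b\<^sup>2 * (c\<^sup>2 * t\<^sup>2 - x\<^sup>2) / 4"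

text \<open>For \<open>r > 0\<close>, \<open>bessel_I 1 (b * r) / r\<close> equals
  \<open>b / 2 * bessel_gen 1 (bessel_arg b c t x)\<close>; this replaces the quotient in
  \<open>kac_density\<close>. With \<open>b = a / c\<close>, the product \<open>b * c\<close> stands
  for the rate \<open>a\<close>.\<close>

definition smooth_density :: "real \<Rightarrow> real \<Rightarrow> real \<Rightarrow> real \<Rightarrow> real" where
  "smooth_density b c t x = exp (- (b * c * t)) / 2 *
     (b\<^sup>2 * c * t / 2 * bessel_gen 1 (bessel_arg b c t x) + b * bessel_gen 0 (bessel_arg b c t x))"

text \<open>Velocity times density: the denominator of the velocity cancels against the bracket of
  the density, which leaves only the \<open>bessel_gen 1\<close> term with \<open>t\<close> replaced
  by \<open>x\<close>.\<close>

definition smooth_flux :: "real \<Rightarrow> real \<Rightarrow> real \<Rightarrow> real \<Rightarrow> real" where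
  "smooth_flux b c t x = exp (- (b * c * t)) / 2 * (b\<^sup>2 * c * x / 2 * bessel_gen 1 (bessel_arg b c t x))"

text \<open>The argument has the partial derivatives \<open>b\<^sup>2 * c\<^sup>2 * t / 2\<close>
  and \<open>- b\<^sup>2 * x / 2\<close>, and each derivative raises the index of
  \<open>bessel_gen\<close>. In the time derivative, the term
  \<open>b ^ 3 * c\<^sup>2 * t / 2 * bessel_gen 1\<close> coming from \<open>bessel_gen 0\<close>
  cancels against the damping.\<close>

lemma C1_with_smooth_density:
  "C1_with (smooth_density b c)
     (\<lambda>t x. exp (- (b * c * t)) / 2 * (b\<^sup>2 * c / 2 * bessel_gen 1 (bessel_arg b c t x)
        + b ^ 4 * c ^ 3 * t\<^sup>2 / 4 * bessel_gen 2 (bessel_arg b c t x)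
        - b\<^sup>2 * c * bessel_gen 0 (bessel_arg b c t x)))
     (\<lambda>t x. exp (- (b * c * t)) / 2 * (- (b ^ 4 * c * t * x / 4 * bessel_gen 2 (bessel_arg b c t x))
        - b ^ 3 * x / 2 * bessel_gen 1 (bessel_arg b c t x)))"
  unfolding C1_with_def
proof (intro conjI allI)
  fix t x :: real
  show "((\<lambda>z. smooth_density b c (fst z) (snd z)) has_derivative
       (\<lambda>h. exp (- (b * c * t)) / 2 * (b\<^sup>2 * c / 2 * bessel_gen 1 (bessel_arg b c t x)
        + b ^ 4 * c ^ 3 * t\<^sup>2 / 4 * bessel_gen 2 (bessel_arg b c t x)
        - b\<^sup>2 * c * bessel_gen 0 (bessel_arg b c t x)) * fst h +
        exp (- (b * c * t)) / 2 * (- (b ^ 4 * c * t * x / 4 * bessel_gen 2 (bessel_arg b c t x))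
        - b ^ 3 * x / 2 * bessel_gen 1 (bessel_arg b c t x)) * snd h)) (at (t, x))"
    unfolding smooth_density_def bessel_arg_def
    by (rule has_derivative_eq_rhs, (rule derivative_intros | simp)+)
      (simp add: fun_eq_iff numeral_2_eq_2 [symmetric],
        simp add: field_simps power2_eq_square power3_eq_cube power4_eq_xxxx)
qed (unfold bessel_arg_def, (intro continuous_intros; simp)+)

lemma C1_with_smooth_flux:
  "C1_with (smooth_flux b c)
     (\<lambda>t x. exp (- (b * c * t)) / 2 * (b ^ 4 * c ^ 3 * t * x / 4 * bessel_gen 2 (bessel_arg b c t x)
        - b ^ 3 * c\<^sup>2 * x / 2 * bessel_gen 1 (bessel_arg b c t x)))
     (\<lambda>t x. exp (- (b * c * t)) / 2 * (b\<^sup>2 * c / 2 * bessel_gen 1 (bessel_arg b c t x)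
        - b ^ 4 * c * x\<^sup>2 / 4 * bessel_gen 2 (bessel_arg b c t x)))"
  unfolding C1_with_def
proof (intro conjI allI)
  fix t x :: real
  show "((\<lambda>z. smooth_flux b c (fst z) (snd z)) has_derivative
       (\<lambda>h. exp (- (b * c * t)) / 2 * (b ^ 4 * c ^ 3 * t * x / 4 * bessel_gen 2 (bessel_arg b c t x)
        - b ^ 3 * c\<^sup>2 * x / 2 * bessel_gen 1 (bessel_arg b c t x)) * fst h +
        exp (- (b * c * t)) / 2 * (b\<^sup>2 * c / 2 * bessel_gen 1 (bessel_arg b c t x)
        - b ^ 4 * c * x\<^sup>2 / 4 * bessel_gen 2 (bessel_arg b c t x)) * snd h)) (at (t, x))"
    unfolding smooth_flux_def bessel_arg_def
    by (rule has_derivative_eq_rhs, (rule derivative_intros | simp)+)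
      (simp add: fun_eq_iff numeral_2_eq_2 [symmetric],
        simp add: field_simps power2_eq_square power3_eq_cube power4_eq_xxxx)
qed (unfold bessel_arg_def, (intro continuous_intros; simp)+)

section \<open>Evolution of means and fluxes\<close>

lemma C1_with_cmult: "C1_with f ft fx \<Longrightarrow> C1_with (\<lambda>t x. k * f t x) (\<lambda>t x. k * ft t x) (\<lambda>t x. k * fx t x)"
  unfolding C1_with_def
  by (auto intro!: continuous_intros derivative_eq_intros simp: algebra_simps)

text \<open>For \<open>t > 0\<close>, \<open>b = a / c\<close> and continuous \<open>f t\<close>,
  this is the integral of \<open>f t\<close> against the law, with the substitution
  \<open>x = c * t * y\<close> in the absolutely continuous part. The formula makes sense for every
  real \<open>t\<close>, so that it can be differentiated on the whole line and evaluated at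
  0.\<close>

definition kac_mean :: "real \<Rightarrow> real \<Rightarrow> (real \<Rightarrow> real \<Rightarrow> real) \<Rightarrow> real \<Rightarrow> real" where
  "kac_mean b c f t = exp (- (b * c * t)) / 2 * (f t (c * t) + f t (- c * t)) +
     c * t * integral {-1..1} (\<lambda>y. smooth_density b c t (c * t * y) * f t (c * t * y))"

text \<open>The corresponding integral of the velocity times \<open>f t\<close>. The atoms move with
  velocities \<open>c\<close> and \<open>- c\<close>, hence the difference.\<close>

definition kac_flux :: "real \<Rightarrow> real \<Rightarrow> (real \<Rightarrow> real \<Rightarrow> real) \<Rightarrow> real \<Rightarrow> real" where
  "kac_flux b c f t = c * exp (- (b * c * t)) / 2 * (f t (c * t) - f t (- c * t)) +
     c * t * integral {-1..1} (\<lambda>y. smooth_flux b c t (c * t * y) * f t (c * t * y))"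

text \<open>The atoms decay at rate \<open>b * c\<close>, and both boundary fluxes equal
  \<open>b * c * (exp (- (b * c * t)) / 2)\<close>: the mass that leaves the atoms enters the
  interior.\<close>

lemma kac_mean_has_real_derivative:
  assumes f: "C1_with f ft fx"
  shows "(kac_mean b c f has_real_derivative kac_mean b c ft t + kac_flux b c fx t) (at t)"
proof -
  let ?p = "smooth_density b c" and ?q = "smooth_flux b c"
  have d: "((\<lambda>t. f t (k * t)) has_real_derivative ft t (k * t) + fx t (k * t) * k) (at t)" for k
    by (rule C1_with_DERIV [OF f]) (auto intro!: derivative_eq_intros)
  note d = d [of c] d [of "- c"]
  have e: "((\<lambda>t. exp (- (b * c * t)) / 2) has_real_derivative - (b * c) * (exp (- (b * c * t)) / 2)) (at t)"
    by (auto intro!: derivative_eq_intros)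
  note cont = f [THEN C1_with_continuous(2)] f [THEN C1_with_continuous(3)]
    C1_with_continuous(1) [OF C1_with_smooth_density] C1_with_continuous(1) [OF C1_with_smooth_flux]
  \<comment> \<open>Up to the exponential factor, the left-hand side is the sum of the time
    derivative of the density and the space derivative of the flux. It equals
    \<open>b\<^sup>2 * c\<close> times the defect in \<open>bessel_gen_ode\<close>, so the balance
    law holds with \<open>\<kappa> = 0\<close>.\<close>
  have bal: "b\<^sup>2 * c / 2 * g1 + b ^ 4 * c ^ 3 * t\<^sup>2 / 4 * g2 - b\<^sup>2 * c * g0
     + (b\<^sup>2 * c / 2 * g1 - b ^ 4 * c * x\<^sup>2 / 4 * g2) = 0"
    if "bessel_arg b c t x * g2 + g1 = g0" for t x g0 g1 g2 :: real
    unfolding that [symmetric] bessel_arg_def by (simp add: field_simps power2_eq_square power3_eq_cube power4_eq_xxxx)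
  have "((\<lambda>t. c * t * integral {-1..1} (\<lambda>y. ?p t (c * t * y) * f t (c * t * y))) has_real_derivative
      c * t * integral {-1..1} (\<lambda>y. ?p t (c * t * y) * ft t (c * t * y) + ?q t (c * t * y) * fx t (c * t * y)
         + 0 * (?p t (c * t * y) * f t (c * t * y)))
      + (c * ?p t (c * t) - ?q t (c * t)) * f t (c * t)
      + (c * ?p t (- c * t) + ?q t (- c * t)) * f t (- c * t)) (at t)"
  proof (rule has_real_derivative_balance_law [OF f C1_with_smooth_density C1_with_smooth_flux])
    fix t x :: real
    show "exp (- (b * c * t)) / 2 * (b\<^sup>2 * c / 2 * bessel_gen 1 (bessel_arg b c t x)
        + b ^ 4 * c ^ 3 * t\<^sup>2 / 4 * bessel_gen 2 (bessel_arg b c t x)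
        - b\<^sup>2 * c * bessel_gen 0 (bessel_arg b c t x)) +
        exp (- (b * c * t)) / 2 * (b\<^sup>2 * c / 2 * bessel_gen 1 (bessel_arg b c t x)
        - b ^ 4 * c * x\<^sup>2 / 4 * bessel_gen 2 (bessel_arg b c t x)) = 0 * ?p t x"
      unfolding distrib_left [symmetric] bal [OF bessel_gen_ode] by simp
  qed
  moreover have "((\<lambda>t. exp (- (b * c * t)) / 2 * (f t (c * t) + f t (- c * t))) has_real_derivative
      - (b * c) * (exp (- (b * c * t)) / 2) * (f t (c * t) + f t (- c * t)) +
      exp (- (b * c * t)) / 2 * (ft t (c * t) + c * fx t (c * t) + ft t (- c * t) - c * fx t (- c * t))) (at t)"
    by (rule DERIV_cong [OF DERIV_mult [OF e DERIV_add [OF d]]]) (simp add: algebra_simps)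
  ultimately have D: "(kac_mean b c f has_real_derivative
     (- (b * c) * (exp (- (b * c * t)) / 2) * (f t (c * t) + f t (- c * t)) +
      exp (- (b * c * t)) / 2 * (ft t (c * t) + c * fx t (c * t) + ft t (- c * t) - c * fx t (- c * t))) +
     (c * t * integral {-1..1} (\<lambda>y. ?p t (c * t * y) * ft t (c * t * y) + ?q t (c * t * y) * fx t (c * t * y)
         + 0 * (?p t (c * t * y) * f t (c * t * y)))
      + (c * ?p t (c * t) - ?q t (c * t)) * f t (c * t)
      + (c * ?p t (- c * t) + ?q t (- c * t)) * f t (- c * t))) (at t)"
    unfolding kac_mean_def [abs_def] by (rule DERIV_add [rotated])
  have I: "integral {-1..1} (\<lambda>y. ?p t (c * t * y) * ft t (c * t * y) + ?q t (c * t * y) * fx t (c * t * y)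
         + 0 * (?p t (c * t * y) * f t (c * t * y))) =
      integral {-1..1} (\<lambda>y. ?p t (c * t * y) * ft t (c * t * y)) +
      integral {-1..1} (\<lambda>y. ?q t (c * t * y) * fx t (c * t * y))"
    unfolding mult_zero_left add_0_right
    by (intro integral_add integrable_continuous_interval continuous_intros cont)
  have B: "c * ?p t (c * t) - ?q t (c * t) = b * c * (exp (- (b * c * t)) / 2)"
    "c * ?p t (- c * t) + ?q t (- c * t) = b * c * (exp (- (b * c * t)) / 2)"
    by (simp_all add: smooth_density_def smooth_flux_def bessel_arg_def field_simps power2_eq_square)
  from D show ?thesis
    unfolding I B kac_mean_def [of b c ft] kac_flux_def [of b c fx]
    by (rule DERIV_cong) (simp add: field_simps)
qed

text \<open>Here the balance law has flux \<open>c\<^sup>2\<close> times the density and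
  \<open>\<kappa> = - 2 * (b * c)\<close>; the \<open>bessel_gen 2\<close> terms cancel identically.
  The boundary terms double the decay of the atomic part, so that it too is damped at rate
  \<open>2 * (b * c)\<close>.\<close>

lemma kac_flux_has_real_derivative:
  assumes f: "C1_with f ft fx"
  shows "(kac_flux b c f has_real_derivative
    kac_flux b c ft t + c\<^sup>2 * kac_mean b c fx t - 2 * (b * c) * kac_flux b c f t) (at t)"
proof -
  let ?p = "smooth_density b c" and ?q = "smooth_flux b c"
  have d: "((\<lambda>t. f t (k * t)) has_real_derivative ft t (k * t) + fx t (k * t) * k) (at t)" for k
    by (rule C1_with_DERIV [OF f]) (auto intro!: derivative_eq_intros)
  note d = d [of c] d [of "- c"]
  have e: "((\<lambda>t. c * exp (- (b * c * t)) / 2) has_real_derivative - (b * c) * (c * exp (- (b * c * t)) / 2)) (at t)"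
    by (auto intro!: derivative_eq_intros)
  let ?q' = "\<lambda>t x. c\<^sup>2 * ?p t x"
  let ?e = "exp (- (b * c * t))"
  note cont = f [THEN C1_with_continuous(1)] f [THEN C1_with_continuous(2)] f [THEN C1_with_continuous(3)]
    C1_with_continuous(1) [OF C1_with_smooth_density] C1_with_continuous(1) [OF C1_with_smooth_flux]
  have "((\<lambda>t. c * t * integral {-1..1} (\<lambda>y. ?q t (c * t * y) * f t (c * t * y))) has_real_derivative
      c * t * integral {-1..1} (\<lambda>y. ?q t (c * t * y) * ft t (c * t * y) + ?q' t (c * t * y) * fx t (c * t * y)
         + - 2 * (b * c) * (?q t (c * t * y) * f t (c * t * y)))
      + (c * ?q t (c * t) - ?q' t (c * t)) * f t (c * t)
      + (c * ?q t (- c * t) + ?q' t (- c * t)) * f t (- c * t)) (at t)"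
  proof (rule has_real_derivative_balance_law [OF f C1_with_smooth_flux C1_with_cmult [OF C1_with_smooth_density]])
    fix t x :: real
    show "exp (- (b * c * t)) / 2 * (b ^ 4 * c ^ 3 * t * x / 4 * bessel_gen 2 (bessel_arg b c t x)
        - b ^ 3 * c\<^sup>2 * x / 2 * bessel_gen 1 (bessel_arg b c t x)) +
       c\<^sup>2 * (exp (- (b * c * t)) / 2 * (- (b ^ 4 * c * t * x / 4 * bessel_gen 2 (bessel_arg b c t x))
        - b ^ 3 * x / 2 * bessel_gen 1 (bessel_arg b c t x))) = - 2 * (b * c) * ?q t x"
      unfolding smooth_flux_def by (simp add: field_simps power2_eq_square power3_eq_cube power4_eq_xxxx)
  qed
  moreover have "((\<lambda>t. c * exp (- (b * c * t)) / 2 * (f t (c * t) - f t (- c * t))) has_real_derivative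
      - (b * c) * (c * ?e / 2) * (f t (c * t) - f t (- c * t)) +
      c * ?e / 2 * (ft t (c * t) + c * fx t (c * t) - ft t (- c * t) + c * fx t (- c * t))) (at t)"
    by (rule DERIV_cong [OF DERIV_mult [OF e DERIV_diff [OF d]]]) (simp add: algebra_simps)
  ultimately have D: "(kac_flux b c f has_real_derivative
     (- (b * c) * (c * ?e / 2) * (f t (c * t) - f t (- c * t)) +
      c * ?e / 2 * (ft t (c * t) + c * fx t (c * t) - ft t (- c * t) + c * fx t (- c * t))) +
     (c * t * integral {-1..1} (\<lambda>y. ?q t (c * t * y) * ft t (c * t * y) + ?q' t (c * t * y) * fx t (c * t * y)
         + - 2 * (b * c) * (?q t (c * t * y) * f t (c * t * y)))
      + (c * ?q t (c * t) - ?q' t (c * t)) * f t (c * t)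
      + (c * ?q t (- c * t) + ?q' t (- c * t)) * f t (- c * t))) (at t)"
    unfolding kac_flux_def [abs_def] by (rule DERIV_add [rotated])
  have I: "integral {-1..1} (\<lambda>y. ?q t (c * t * y) * ft t (c * t * y) + ?q' t (c * t * y) * fx t (c * t * y)
         + - 2 * (b * c) * (?q t (c * t * y) * f t (c * t * y))) =
      integral {-1..1} (\<lambda>y. ?q t (c * t * y) * ft t (c * t * y)) +
      integral {-1..1} (\<lambda>y. c\<^sup>2 * (?p t (c * t * y) * fx t (c * t * y))) +
      integral {-1..1} (\<lambda>y. - 2 * (b * c) * (?q t (c * t * y) * f t (c * t * y)))"
    unfolding mult.assoc [of "c\<^sup>2"]
    by (subst integral_add, (intro integrable_continuous_interval continuous_intros cont)+)
      (intro arg_cong2 [where f = "(+)"] integral_add refl integrable_continuous_interval continuous_intros cont)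
  have B: "c * ?q t (c * t) - ?q' t (c * t) = - b * c * (c * ?e / 2)"
    "c * ?q t (- c * t) + ?q' t (- c * t) = b * c * (c * ?e / 2)"
    by (simp_all add: smooth_density_def smooth_flux_def bessel_arg_def field_simps power2_eq_square)
  from D show ?thesis
    unfolding I B kac_mean_def kac_flux_def [of b c ft] kac_flux_def [of b c f t] integral_mult_right
    by (rule DERIV_cong) (simp add: field_simps power2_eq_square)
qed

section \<open>Integration against the Kac law\<close>

lemma smooth_density_nonneg:
  assumes "b \<ge> 0" "c \<ge> 0" "t \<ge> 0" "x \<in> {- c * t..c * t}"
  shows "smooth_density b c t x \<ge> 0"
proof -
  have "\<bar>x\<bar> \<le> \<bar>c * t\<bar>"
    using assms by auto
  then have "x\<^sup>2 \<le> (c * t)\<^sup>2"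
    by (simp add: abs_le_square_iff)
  then have "bessel_arg b c t x \<ge> 0"
    by (simp add: bessel_arg_def power_mult_distrib)
  then show ?thesis
    using assms unfolding smooth_density_def
    by (intro mult_nonneg_nonneg add_nonneg_nonneg less_imp_le [OF bessel_gen_pos]) auto
qed

text \<open>Only the open cone is covered: at \<open>x = c * t\<close> and
  \<open>x = - c * t\<close> the radius vanishes and the quotients in the given formulas
  degenerate.\<close>

lemma
  assumes "a > 0" "c > 0" "t > 0" "x \<in> {- c * t<..<c * t}"
  shows kac_density_eq_smooth_density: "kac_density a c t x = smooth_density (a / c) c t x"
    and kac_velocity_density: "kac_velocity a c v \<Longrightarrow> v t x * smooth_density (a / c) c t x = smooth_flux (a / c) c t x"
proof -
  define r where "r = kac_radius c t x"
  define b where "b = a / c"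
  have a: "a = b * c" and b: "b > 0"
    using assms by (auto simp: b_def)
  have "\<bar>x\<bar> < c * t"
    using assms by auto
  then have "\<bar>x\<bar>\<^sup>2 < (c * t)\<^sup>2"
    by (rule power_strict_mono) auto
  then have "x\<^sup>2 < (c * t)\<^sup>2"
    by simp
  then have r: "r > 0" and r2: "r\<^sup>2 = c\<^sup>2 * t\<^sup>2 - x\<^sup>2"
    by (simp_all add: r_def kac_radius_def power_mult_distrib)
  have Y: "(b * r)\<^sup>2 / 4 = bessel_arg b c t x"
    by (simp add: bessel_arg_def power_mult_distrib r2)
  have I0: "bessel_I 0 (b * r) = bessel_gen 0 (bessel_arg b c t x)"
    and I1: "bessel_I 1 (b * r) = b * r / 2 * bessel_gen 1 (bessel_arg b c t x)"
    by (simp_all add: bessel_I_eq_gen Y)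
  have dens: "kac_density a c t x = smooth_density b c t x"
    using assms r
    unfolding kac_density_def Let_def bessel_I0'_eq r_def [symmetric] b_def [symmetric] I0 I1 smooth_density_def
    by (simp add: a indicator_def power2_eq_square)
  then show "kac_density a c t x = smooth_density (a / c) c t x"
    by (simp add: b_def)
  define g0 g1 where "g0 = bessel_gen 0 (bessel_arg b c t x)" and "g1 = bessel_gen 1 (bessel_arg b c t x)"
  have "bessel_arg b c t x \<ge> 0"
    unfolding Y [symmetric] by simp
  then have g: "g0 > 0" "g1 > 0"
    by (auto simp: g0_def g1_def bessel_gen_pos)
  assume "kac_velocity a c v"
  then have "v t x = x / (t + r / c * (bessel_I 0 (b * r) / bessel_I 1 (b * r)))"
    using assms unfolding kac_velocity_def Let_def bessel_I0'_eq r_def b_def by auto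
  also have "\<dots> = x / (t + r / c * (g0 / (b * r / 2 * g1)))"
    unfolding I0 I1 g0_def g1_def ..
  also have "r / c * (g0 / (b * r / 2 * g1)) = 2 * g0 / (b * c * g1)"
    using r by (simp add: ac_simps)
  also have "x / (t + 2 * g0 / (b * c * g1)) = x * (b * c * g1) / (b * c * t * g1 + 2 * g0)"
    using g b assms by (simp add: field_simps)
  finally have "v t x * (b\<^sup>2 * c * t / 2 * g1 + b * g0) = x * (b * c * g1) / (b * c * t * g1 + 2 * g0) * (b\<^sup>2 * c * t / 2 * g1 + b * g0)"
    by simp
  \<comment> \<open>The bracket of the density is \<open>b / 2\<close> times the denominator of the
    velocity, so that the quotient disappears.\<close>
  also have E: "b\<^sup>2 * c * t / 2 * g1 + b * g0 = (b * c * t * g1 + 2 * g0) * (b / 2)"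
    by (simp add: power2_eq_square field_simps)
  also have "x * (b * c * g1) / (b * c * t * g1 + 2 * g0) * ((b * c * t * g1 + 2 * g0) * (b / 2)) = x * (b * c * g1) * (b / 2)"
  proof -
    have "b * c * t * g1 + 2 * g0 > 0"
      using g b assms by (intro add_pos_pos mult_pos_pos) auto
    then show ?thesis
      by simp
  qed
  finally have V0: "v t x * ((b * c * t * g1 + 2 * g0) * (b / 2)) = x * (b * c * g1) * (b / 2)" .
  have V: "v t x * (b\<^sup>2 * c * t / 2 * g1 + b * g0) = b\<^sup>2 * c * x / 2 * g1"
    unfolding E V0 by (simp add: power2_eq_square)
  show "v t x * smooth_density (a / c) c t x = smooth_flux (a / c) c t x"
    unfolding smooth_density_def smooth_flux_def b_def [symmetric] g0_def [symmetric] g1_def [symmetric]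
      mult.left_commute [of "v t x"] V ..
qed

text \<open>The law is given by its values on Borel sets; the formula passes to functions through
  indicators, multiples, sums and increasing limits.\<close>

lemma nn_integral_kac_law:
  assumes "f \<in> borel_measurable borel"
  shows "(\<integral>\<^sup>+x. f x \<partial>kac_law a c t) =
    ennreal (exp (- a * t) / 2) * (f (- c * t) + f (c * t)) + (\<integral>\<^sup>+x. f x \<partial>density lborel (kac_density a c t))"
  using assms
proof (induction rule: borel_measurable_induct)
  case (set A)
  then show ?case
    by (simp add: emeasure_kac_law emeasure_density)
next
  case (mult u k)
  then show ?case
    by (subst (1 2) nn_integral_cmult) (simp_all add: algebra_simps measurable_cong_sets [OF sets_kac_law refl])
next
  case (add u v)
  then show ?case
    by (subst (1 2) nn_integral_add) (simp_all add: algebra_simps measurable_cong_sets [OF sets_kac_law refl])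
next
  case (seq U)
  let ?e = "ennreal (exp (- a * t) / 2)" and ?D = "density lborel (kac_density a c t)"
  have inc: "incseq (\<lambda>i. U i x)" for x
    using seq by (auto simp: incseq_def le_fun_def)
  have inc2: "incseq (\<lambda>i. ?e * (U i (- c * t) + U i (c * t)))"
    using seq by (auto simp: incseq_def le_fun_def intro!: mult_left_mono add_mono)
  have inc3: "incseq (\<lambda>i. integral\<^sup>N ?D (U i))"
    using seq by (auto simp: incseq_def le_fun_def intro!: nn_integral_mono)
  have "(\<integral>\<^sup>+x. (SUP i. U i x) \<partial>kac_law a c t) = (SUP i. integral\<^sup>N (kac_law a c t) (U i))"
    using seq by (intro nn_integral_monotone_convergence_SUP) (auto simp: measurable_cong_sets [OF sets_kac_law refl])
  also have "\<dots> = (SUP i. ?e * (U i (- c * t) + U i (c * t)) + integral\<^sup>N ?D (U i))"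
    using seq by simp
  also have "\<dots> = (SUP i. ?e * (U i (- c * t) + U i (c * t))) + (SUP i. integral\<^sup>N ?D (U i))"
    by (rule ennreal_SUP_add [OF inc2 inc3])
  also have "(SUP i. ?e * (U i (- c * t) + U i (c * t))) = ?e * ((SUP i. U i (- c * t)) + (SUP i. U i (c * t)))"
    by (simp only: SUP_mult_left_ennreal [symmetric] ennreal_SUP_add [OF inc inc])
  also have "(SUP i. integral\<^sup>N ?D (U i)) = (\<integral>\<^sup>+x. (SUP i. U i x) \<partial>?D)"
    using seq by (intro nn_integral_monotone_convergence_SUP [symmetric]) auto
  finally show ?case
    by (simp add: image_comp)
qed auto

text \<open>Integrability is only at stake for the absolutely continuous part, since each atom
  contributes a finite value. The integral is computed from the positive and negative parts.\<close>

lemma has_bochner_integral_kac_law: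
  fixes f :: "real \<Rightarrow> real"
  assumes "has_bochner_integral (density lborel (kac_density a c t)) f I" "f \<in> borel_measurable borel"
  shows "has_bochner_integral (kac_law a c t) f (exp (- a * t) / 2 * (f (- c * t) + f (c * t)) + I)"
proof -
  let ?M = "kac_law a c t" and ?D = "density lborel (kac_density a c t)"
  let ?e = "exp (- a * t) / 2"
  have [measurable]: "f \<in> borel_measurable ?M" "f \<in> borel_measurable borel"
    using assms(2) by (simp_all add: measurable_cong_sets [OF sets_kac_law refl])
  have D: "integrable ?D f" "integral\<^sup>L ?D f = I"
    using assms by (auto simp: has_bochner_integral_iff)
  have m: "ennreal (max 0 x) = ennreal x" for x
    by (simp add: max_def ennreal_neg)
  have mm: "(max 0 x + max 0 y) - (max 0 (- x) + max 0 (- y)) = x + y" for x y :: real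
    by (simp add: max_def)
  \<comment> \<open>\<open>ennreal\<close> sends negative reals to 0, so the atoms contribute
    \<open>max 0\<close> of the values of \<open>g\<close>.\<close>
  have pos: "(\<integral>\<^sup>+x. ennreal (g x) \<partial>?M) = ennreal (?e * (max 0 (g (- c * t)) + max 0 (g (c * t)))) + (\<integral>\<^sup>+x. ennreal (g x) \<partial>?D)"
    if [measurable]: "g \<in> borel_measurable borel" for g :: "real \<Rightarrow> real"
  proof -
    have "ennreal (?e * (max 0 (g (- c * t)) + max 0 (g (c * t)))) = ennreal ?e * (ennreal (g (- c * t)) + ennreal (g (c * t)))"
      by (subst ennreal_mult, simp, simp, subst ennreal_plus, simp, simp, simp only: m)
    then show ?thesis
      by (subst nn_integral_kac_law) auto
  qed
  have fin: "(\<integral>\<^sup>+x. ennreal (g x) \<partial>?D) < \<infinity>" if "g = f \<or> g = (\<lambda>x. - f x) \<or> g = (\<lambda>x. \<bar>f x\<bar>)" for g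
  proof -
    have "(\<integral>\<^sup>+x. ennreal (g x) \<partial>?D) \<le> (\<integral>\<^sup>+x. ennreal (norm (f x)) \<partial>?D)"
      using that by (intro nn_integral_mono ennreal_leI) (elim disjE; simp)
    also have "\<dots> < \<infinity>"
      using D(1) by (simp add: integrable_iff_bounded)
    finally show ?thesis .
  qed
  have "(\<integral>\<^sup>+x. ennreal (norm (f x)) \<partial>?M) < \<infinity>"
    using fin [of "\<lambda>x. \<bar>f x\<bar>"] by (subst pos) (simp_all add: ennreal_less_top del: ennreal_plus)
  then have int: "integrable ?M f"
    by (simp add: integrable_iff_bounded)
  have "integral\<^sup>L ?M f = enn2real (\<integral>\<^sup>+x. ennreal (f x) \<partial>?M) - enn2real (\<integral>\<^sup>+x. ennreal (- f x) \<partial>?M)"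
    by (rule real_lebesgue_integral_def [OF int])
  also have "\<dots> = ?e * (max 0 (f (- c * t)) + max 0 (f (c * t))) - ?e * (max 0 (- f (- c * t)) + max 0 (- f (c * t)))
      + (enn2real (\<integral>\<^sup>+x. ennreal (f x) \<partial>?D) - enn2real (\<integral>\<^sup>+x. ennreal (- f x) \<partial>?D))"
    using fin [of f] fin [of "\<lambda>x. - f x"] by (subst (1 2) pos) (simp_all add: enn2real_plus ennreal_less_top del: ennreal_plus)
  also have "enn2real (\<integral>\<^sup>+x. ennreal (f x) \<partial>?D) - enn2real (\<integral>\<^sup>+x. ennreal (- f x) \<partial>?D) = I"
    using real_lebesgue_integral_def [OF D(1)] D(2) by simp
  also have "?e * (max 0 (f (- c * t)) + max 0 (f (c * t))) - ?e * (max 0 (- f (- c * t)) + max 0 (- f (c * t))) =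
      ?e * (f (- c * t) + f (c * t))"
    unfolding right_diff_distrib [symmetric] mm ..
  finally show ?thesis
    using int by (simp add: has_bochner_integral_iff)
qed

text \<open>The function \<open>f\<close> may be irregular, as the velocity is: only its product
  with the density has to agree with a continuous \<open>h\<close>, and only inside the open cone.
  The values of \<open>f\<close> at the two boundary points enter through the atoms.\<close>

lemma has_bochner_integral_kac_law_cone:
  fixes f h :: "real \<Rightarrow> real"
  assumes "a > 0" "c > 0" "t > 0" and f [measurable]: "f \<in> borel_measurable borel"
    and h: "continuous_on UNIV h"
    and eq: "\<And>x. x \<in> {- c * t<..<c * t} \<Longrightarrow> f x * smooth_density (a / c) c t x = h x"
  shows "has_bochner_integral (kac_law a c t) f
    (exp (- a * t) / 2 * (f (- c * t) + f (c * t)) + c * t * integral {-1..1} (\<lambda>y. h (c * t * y)))"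
proof (rule has_bochner_integral_kac_law)
  let ?S = "{- c * t..c * t}"
  \<comment> \<open>The two boundary points, where \<open>kac_density\<close> involves 0 / 0, form a
    Lebesgue null set.\<close>
  have ae: "AE x in lborel. x \<notin> {c * t, - c * t}"
    by (intro AE_not_in finite_imp_null_set_lborel) auto
  have dens: "kac_density a c t x * f x = indicator ?S x * h x" and dens_nn: "kac_density a c t x \<ge> 0"
    if "x \<notin> {c * t, - c * t}" for x
  proof -
    have "kac_density a c t x * f x = indicator ?S x * h x \<and> kac_density a c t x \<ge> 0"
    proof (cases "x \<in> ?S")
      case True
      with that have "x \<in> {- c * t<..<c * t}"
        by (auto simp: less_le)
      with True assms(1-3) show ?thesis
        using smooth_density_nonneg [of "a / c" c t x] eq [of x]
        by (simp add: kac_density_eq_smooth_density mult.commute)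
    next
      case False
      then show ?thesis
        by (simp add: kac_density_def Let_def)
    qed
    then show "kac_density a c t x * f x = indicator ?S x * h x" "kac_density a c t x \<ge> 0"
      by auto
  qed
  have [measurable]: "h \<in> borel_measurable borel"
    using h by (simp add: borel_measurable_continuous_onI)
  have "set_integrable lborel ?S h"
    by (intro borel_integrable_atLeastAtMost' continuous_on_subset [OF h]) auto
  then have "has_bochner_integral lborel (\<lambda>x. indicator ?S x *\<^sub>R h x) (integral ?S h)"
    using set_borel_integral_eq_integral(2) [of ?S h]
    by (simp add: has_bochner_integral_iff set_integrable_def set_lebesgue_integral_def)
  also have "?this \<longleftrightarrow> has_bochner_integral lborel (\<lambda>x. kac_density a c t x *\<^sub>R f x) (integral ?S h)"
  proof (rule has_bochner_integral_cong_AE)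
    show "AE x in lborel. indicator ?S x *\<^sub>R h x = kac_density a c t x *\<^sub>R f x"
      using ae by (rule eventually_mono) (unfold real_scaleR_def, rule dens [symmetric])
  qed measurable
  finally have "has_bochner_integral (density lborel (kac_density a c t)) f (integral ?S h)"
    by (intro has_bochner_integral_density eventually_mono [OF ae] dens_nn) simp_all
  moreover have "integral ?S h = c * t * integral {-1..1} (\<lambda>y. h (c * t * y))"
  proof -
    have "(h has_integral integral ?S h) (cbox (- c * t) (c * t))"
      using integrable_integral [OF integrable_continuous_interval [OF continuous_on_subset [OF h]]] by auto
    from has_integral_affinity' [OF this, of "c * t" 0] assms(1-3)
    have "((\<lambda>y. h (c * t * y)) has_integral integral ?S h / (c * t)) {-1..1}"
      by (simp add: field_simps)
    then show ?thesis
      using assms(1-3) by (simp add: integral_unique)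
  qed
  ultimately show "has_bochner_integral (density lborel (kac_density a c t)) f
      (c * t * integral {-1..1} (\<lambda>y. h (c * t * y)))"
    by simp
qed fact

lemma has_bochner_integral_kac_law_kac_mean:
  assumes "a > 0" "c > 0" "t > 0" and f: "continuous_on UNIV (f t)"
  shows "has_bochner_integral (kac_law a c t) (f t) (kac_mean (a / c) c f t)"
proof -
  have "has_bochner_integral (kac_law a c t) (f t)
    (exp (- a * t) / 2 * (f t (- c * t) + f t (c * t)) +
     c * t * integral {-1..1} (\<lambda>y. smooth_density (a / c) c t (c * t * y) * f t (c * t * y)))"
    using assms
    by (intro has_bochner_integral_kac_law_cone borel_measurable_continuous_onI continuous_intros
        C1_with_continuous(1) [OF C1_with_smooth_density]) auto
  then show ?thesis
    using assms by (simp add: kac_mean_def add.commute)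
qed

lemma has_bochner_integral_kac_law_continuity_equation:
  assumes "a > 0" "c > 0" "t > 0" and v: "kac_velocity a c v"
    and f: "continuous_on UNIV (f t)" and g: "continuous_on UNIV (g t)"
  shows "has_bochner_integral (kac_law a c t) (\<lambda>x. f t x + v t x * g t x)
    (kac_mean (a / c) c f t + kac_flux (a / c) c g t)"
proof -
  let ?p = "smooth_density (a / c) c t" and ?q = "smooth_flux (a / c) c t"
  have cont: "continuous_on S f \<Longrightarrow> continuous_on S (\<lambda>x. ?p (f x))" 
    "continuous_on S f \<Longrightarrow> continuous_on S (\<lambda>x. ?q (f x))" for S and f :: "real \<Rightarrow> real"
    by (intro C1_with_continuous(1) [OF C1_with_smooth_density] C1_with_continuous(1) [OF C1_with_smooth_flux]
        continuous_intros; assumption)+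
  have cfg: "continuous_on S h \<Longrightarrow> continuous_on S (\<lambda>x. f t (h x))"
    "continuous_on S h \<Longrightarrow> continuous_on S (\<lambda>x. g t (h x))" for S and h :: "real \<Rightarrow> real"
    using continuous_on_compose2 [OF f] continuous_on_compose2 [OF g] by auto
  \<comment> \<open>The section at time \<open>t\<close> of the jointly measurable velocity is
    measurable, since the line at \<open>t > 0\<close> stays in the open half plane.\<close>
  have "(\<lambda>x. (t, x)) \<in> borel \<rightarrow>\<^sub>M restrict_space borel ({0<..} \<times> UNIV)"
    using \<open>t > 0\<close>
    by (intro measurable_restrict_space2 borel_measurable_continuous_onI continuous_intros) auto
  moreover have "(\<lambda>(t, x). v t x) \<in> borel_measurable (restrict_space borel ({0<..} \<times> UNIV))"
    using v by (simp add: kac_velocity_def)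
  ultimately have "(\<lambda>x. case (t, x) of (t, x) \<Rightarrow> v t x) \<in> borel_measurable borel"
    by (rule measurable_compose)
  then have [measurable]: "v t \<in> borel_measurable borel"
    by simp
  have [measurable]: "f t \<in> borel_measurable borel" "g t \<in> borel_measurable borel"
    using f g by (auto intro: borel_measurable_continuous_onI)
  have "has_bochner_integral (kac_law a c t) (\<lambda>x. f t x + v t x * g t x)
     (exp (- a * t) / 2 * ((f t (- c * t) + v t (- c * t) * g t (- c * t)) + (f t (c * t) + v t (c * t) * g t (c * t))) +
     c * t * integral {-1..1} (\<lambda>y. ?p (c * t * y) * f t (c * t * y) + ?q (c * t * y) * g t (c * t * y)))"
  proof (rule has_bochner_integral_kac_law_cone [OF assms(1-3)])
    show "continuous_on UNIV (\<lambda>x. ?p x * f t x + ?q x * g t x)"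
      by (intro continuous_intros cont cfg)
    fix x assume "x \<in> {- c * t<..<c * t}"
    from kac_velocity_density [OF assms(1-3) this v]
    show "(f t x + v t x * g t x) * ?p x = ?p x * f t x + ?q x * g t x"
      by (simp add: algebra_simps)
  qed measurable
  moreover have "integral {-1..1} (\<lambda>y. ?p (c * t * y) * f t (c * t * y) + ?q (c * t * y) * g t (c * t * y)) =
      integral {-1..1} (\<lambda>y. ?p (c * t * y) * f t (c * t * y)) + integral {-1..1} (\<lambda>y. ?q (c * t * y) * g t (c * t * y))"
    by (intro integral_add integrable_continuous_interval continuous_intros cont cfg)
  moreover have "v t (c * t) = c" "v t (- c * t) = - c"
    using v \<open>t > 0\<close> by (auto simp: kac_velocity_def)
  ultimately show ?thesis
    using assms(1-3) unfolding kac_mean_def kac_flux_def by (simp add: algebra_simps)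
qed

section \<open>The characteristic function of the Kac law\<close>

text \<open>In the energy of the difference, the weight \<open>c\<^sup>2\<close> makes the terms
  with \<open>k\<close> cancel, which leaves the derivative
  \<open>- 4 * a * (D s - D' s)\<^sup>2\<close>. Derivatives are taken within \<open>{0..}\<close>
  because the expectations along the process are only controlled at nonnegative times.\<close>

lemma telegraph_unique:
  fixes A D A' D' :: "real \<Rightarrow> real"
  assumes "a \<ge> 0" "c \<noteq> 0" "t \<ge> 0"
    and A: "\<And>t. t \<ge> 0 \<Longrightarrow> (A has_real_derivative - k * D t) (at t within {0..})"
    and D: "\<And>t. t \<ge> 0 \<Longrightarrow> (D has_real_derivative c\<^sup>2 * k * A t - 2 * a * D t) (at t within {0..})"
    and A': "\<And>t. t \<ge> 0 \<Longrightarrow> (A' has_real_derivative - k * D' t) (at t within {0..})"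
    and D': "\<And>t. t \<ge> 0 \<Longrightarrow> (D' has_real_derivative c\<^sup>2 * k * A' t - 2 * a * D' t) (at t within {0..})"
    and "A 0 = A' 0" "D 0 = D' 0"
  shows "A t = A' t"
proof -
  define E where "E s = c\<^sup>2 * (A s - A' s)\<^sup>2 + (D s - D' s)\<^sup>2" for s
  have dE: "(E has_real_derivative - 4 * a * (D s - D' s)\<^sup>2) (at s within {0..})" if "s \<ge> 0" for s
    unfolding E_def [abs_def]
    by (rule derivative_eq_intros A [OF that] D [OF that] A' [OF that] D' [OF that] refl)+
      (simp add: algebra_simps power2_eq_square)
  have "E t \<le> E 0"
    using \<open>t \<ge> 0\<close>
  proof (rule DERIV_nonpos_imp_decreasing_open)
      fix s :: real
      assume s: "0 < s" "s < t"
      then have "at s within {0..} = at s"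
        by (intro at_within_interior) auto
      with dE [of s] s \<open>a \<ge> 0\<close> show "\<exists>y. (E has_real_derivative y) (at s) \<and> y \<le> 0"
        by (intro exI [of _ "- 4 * a * (D s - D' s)\<^sup>2"]) auto
    next
      have "continuous_on {0..} E"
        using dE by (intro DERIV_continuous_on) auto
      then show "continuous_on {0..t} E"
        by (rule continuous_on_subset) auto
  qed
  then have "c\<^sup>2 * (A t - A' t)\<^sup>2 + (D t - D' t)\<^sup>2 \<le> 0"
    using assms by (simp add: E_def)
  then have "c\<^sup>2 * (A t - A' t)\<^sup>2 \<le> 0"
    by (smt (verit) zero_le_power2)
  with \<open>c \<noteq> 0\<close> show ?thesis
    by (simp add: mult_le_0_iff)
qed

lemma kac_mean_cmult: "kac_mean b c (\<lambda>t x. k * f t x) t = k * kac_mean b c f t"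
  and kac_flux_cmult: "kac_flux b c (\<lambda>t x. k * f t x) t = k * kac_flux b c f t"
proof -
  have *: "integral S (\<lambda>y. p y * (k * f y)) = k * integral S (\<lambda>y. p y * f y)" for p f :: "real \<Rightarrow> real" and S
    by (subst integral_mult_right [symmetric]) (simp only: mult.left_commute)
  show "kac_mean b c (\<lambda>t x. k * f t x) t = k * kac_mean b c f t"
    "kac_flux b c (\<lambda>t x. k * f t x) t = k * kac_flux b c f t"
    unfolding kac_mean_def kac_flux_def * by (simp_all add: field_simps)
qed

lemma kac_mean_zero [simp]: "kac_mean b c (\<lambda>t x. 0) t = 0"
  and kac_flux_zero [simp]: "kac_flux b c (\<lambda>t x. 0) t = 0"
  by (simp_all add: kac_mean_def kac_flux_def)

lemma
  shows C1_with_cos: "C1_with (\<lambda>t x. cos (k * x)) (\<lambda>t x. 0) (\<lambda>t x. - k * sin (k * x))"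
    and C1_with_sin: "C1_with (\<lambda>t x. sin (k * x)) (\<lambda>t x. 0) (\<lambda>t x. k * cos (k * x))"
  unfolding C1_with_def
  by (auto intro!: continuous_intros derivative_eq_intros)

lemma telegraph_cos:
  shows "(kac_mean b c (\<lambda>t x. cos (k * x)) has_real_derivative - k * kac_flux b c (\<lambda>t x. sin (k * x)) t) (at t)"
    and "(kac_flux b c (\<lambda>t x. sin (k * x)) has_real_derivative
      c\<^sup>2 * k * kac_mean b c (\<lambda>t x. cos (k * x)) t - 2 * (b * c) * kac_flux b c (\<lambda>t x. sin (k * x)) t) (at t)"
  using kac_mean_has_real_derivative [OF C1_with_cos, of b c k t]
    kac_flux_has_real_derivative [OF C1_with_sin, of b c k t]
  by (simp_all only: kac_mean_cmult kac_flux_cmult kac_mean_zero kac_flux_zero add_0_left mult.assoc)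

text \<open>This expresses the symmetry of the law. The mean of the sine and the flux of the cosine
  solve the telegraph system with \<open>- k\<close> in place of \<open>k\<close> and vanish at time
  0, so they are compared with the zero solution.\<close>

lemma kac_mean_sin:
  assumes "b \<ge> 0" "c > 0" "t \<ge> 0"
  shows "kac_mean b c (\<lambda>t x. sin (k * x)) t = 0"
proof (rule telegraph_unique [where A = "kac_mean b c (\<lambda>t x. sin (k * x))" and A' = "\<lambda>t. 0" and t = t and D = "kac_flux b c (\<lambda>t x. cos (k * x))" and D' = "\<lambda>t. 0" and k = "- k"
      and a = "b * c" and c = c])
  fix t
  show "(kac_mean b c (\<lambda>t x. sin (k * x)) has_real_derivative
      - (- k) * kac_flux b c (\<lambda>t x. cos (k * x)) t) (at t within {0..})"
    using kac_mean_has_real_derivative [OF C1_with_sin, of b c k t]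
    by (simp only: kac_flux_cmult kac_mean_zero add_0_left minus_minus has_field_derivative_at_within)
  show "(kac_flux b c (\<lambda>t x. cos (k * x)) has_real_derivative
      c\<^sup>2 * - k * kac_mean b c (\<lambda>t x. sin (k * x)) t - 2 * (b * c) * kac_flux b c (\<lambda>t x. cos (k * x)) t)
      (at t within {0..})"
    using kac_flux_has_real_derivative [OF C1_with_cos, of b c k t]
    by (simp only: kac_mean_cmult kac_flux_zero add_0_left mult.assoc has_field_derivative_at_within)
qed (use assms in \<open>auto simp: kac_mean_def kac_flux_def\<close>)

lemma prob_space_kac_law:
  assumes "a > 0" "c > 0" "t > 0"
  shows "prob_space (kac_law a c t)"
proof
  let ?M = "kac_law a c t"
  let ?one = "(\<lambda>t x. 1) :: real \<Rightarrow> real \<Rightarrow> real"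
  have "C1_with ?one (\<lambda>t x. 0) (\<lambda>t x. 0)"
    by (simp add: C1_with_def)
  from kac_mean_has_real_derivative [OF this]
  have "(kac_mean (a / c) c ?one has_real_derivative 0) (at t)" for t
    by simp
  \<comment> \<open>The explicit formula has derivative 0 on the whole line, and at time 0 only the
    two atomic weights 1 / 2 remain.\<close>
  then have "kac_mean (a / c) c ?one t = kac_mean (a / c) c ?one 0"
    by (intro DERIV_isconst_all) auto
  also have "\<dots> = 1"
    by (simp add: kac_mean_def)
  finally have 1: "has_bochner_integral ?M (\<lambda>x. 1) (1 :: real)"
    using has_bochner_integral_kac_law_kac_mean [OF assms, of ?one] by simp
  then have "emeasure ?M (space ?M) \<noteq> \<infinity>"
    by (auto simp: has_bochner_integral_iff integrable_iff_bounded)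
  moreover have "measure ?M (space ?M) = 1"
    using 1 by (simp add: has_bochner_integral_iff)
  ultimately show "emeasure ?M (space ?M) = 1"
    by (simp add: emeasure_eq_ennreal_measure)
qed

lemma char_kac_law:
  assumes "a > 0" "c > 0" "t > 0"
  shows "char (kac_law a c t) k = complex_of_real (kac_mean (a / c) c (\<lambda>t x. cos (k * x)) t)"
proof -
  interpret prob_space "kac_law a c t"
    by (rule prob_space_kac_law) fact+
  have int: "integrable (kac_law a c t) (\<lambda>x. iexp (k * x))"
    by (rule integrable_const_bound [where B = 1]) (auto simp: measurable_cong_sets [OF sets_kac_law refl])
  have "Re (char (kac_law a c t) k) = kac_mean (a / c) c (\<lambda>t x. cos (k * x)) t"
    unfolding char_def integral_Re [OF int, symmetric]
    using has_bochner_integral_kac_law_kac_mean [OF assms, of "\<lambda>t x. cos (k * x)"]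
    by (simp add: has_bochner_integral_iff continuous_intros Re_exp)
  moreover have "Im (char (kac_law a c t) k) = 0"
    unfolding char_def integral_Im [OF int, symmetric]
    using has_bochner_integral_kac_law_kac_mean [OF assms, of "\<lambda>t x. sin (k * x)"] kac_mean_sin [of "a / c" c t k] assms
    by (simp add: has_bochner_integral_iff continuous_intros Im_exp)
  ultimately show ?thesis
    by (simp add: complex_eq_iff)
qed

text \<open>At time 0 the atoms, of weight 1 / 2 each, merge at 0, and the density is supported in
  the null set \<open>{0}\<close>.\<close>

lemma kac_law_0: "kac_law a c 0 = return borel 0"
proof (rule measure_eqI)
  fix A :: "real set"
  assume "A \<in> sets (kac_law a c 0)"
  then have A: "A \<in> sets borel"
    by simp
  have "(\<integral>\<^sup>+x\<in>A. ennreal (kac_density a c 0 x) \<partial>lborel) = (\<integral>\<^sup>+x. 0 \<partial>(lborel :: real measure))"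
  proof (rule nn_integral_cong_AE)
    have "AE x in lborel. x \<notin> {0 :: real}"
      by (intro AE_not_in finite_imp_null_set_lborel) auto
    then show "AE x in lborel. ennreal (kac_density a c 0 x) * indicator A x = 0"
      by (rule eventually_mono) (simp add: kac_density_def Let_def)
  qed
  moreover have "ennreal (1 / 2) * (x + x) = x" for x
  proof -
    have "ennreal (1 / 2) * (x + x) = ennreal (1 / 2) * 2 * x"
      by (simp add: mult_2 [symmetric] mult.assoc)
    also have "ennreal (1 / 2) * 2 = ennreal (1 / 2 * 2)"
      by (subst ennreal_mult) auto
    finally show ?thesis
      by simp
  qed
  ultimately show "emeasure (kac_law a c 0) A = emeasure (return borel 0) A"
    by (simp add: emeasure_kac_law [OF A])
qed simp

section \<open>The continuity equation\<close>

text \<open>Only continuity of \<open>f\<close> is assumed, since the lemma is applied to the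
  partial derivatives of a test function.\<close>

lemma continuous_on_kac_mean:
  assumes "continuous_on UNIV (\<lambda>z. f (fst z) (snd z))"
  shows "continuous_on S (kac_mean b c f)" "continuous_on S (kac_flux b c f)"
proof -
  have f: "continuous_on S p \<Longrightarrow> continuous_on S q \<Longrightarrow> continuous_on S (\<lambda>s. f (p s) (q s))"
    for S :: "'z::topological_space set" and p q
    using assms by (rule continuous_on_uncurried)
  note cont = continuous_on_uncurried [OF assms]
    C1_with_continuous(1) [OF C1_with_smooth_density] C1_with_continuous(1) [OF C1_with_smooth_flux]
  have "continuous_on S (\<lambda>t. integral (cbox (-1) 1) (\<lambda>y. smooth_density b c t (c * t * y) * f t (c * t * y)))"
    "continuous_on S (\<lambda>t. integral (cbox (-1) 1) (\<lambda>y. smooth_flux b c t (c * t * y) * f t (c * t * y)))"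
    by (intro integral_continuous_on_param, unfold case_prod_beta, intro continuous_intros cont)+
  then show "continuous_on S (kac_mean b c f)" "continuous_on S (kac_flux b c f)"
    unfolding kac_mean_def [abs_def] kac_flux_def [abs_def] cbox_interval
    by (intro continuous_intros cont; simp)+
qed

text \<open>\<open>Ck\<close> speaks of Frechet derivatives in the basis directions and
  \<open>continuity_integrand\<close> of derivatives in one variable; the chain rule along
  coordinate lines identifies them.\<close>

lemma Ck_1_C1_with:
  fixes \<psi> :: "real \<times> real \<Rightarrow> real"
  assumes "Ck 1 \<psi>"
  shows "C1_with (\<lambda>t x. \<psi> (t, x)) (\<lambda>t x. deriv (\<lambda>s. \<psi> (s, x)) t) (\<lambda>t x. deriv (\<lambda>y. \<psi> (t, y)) x)"
proof -
  let ?D = "\<lambda>z. frechet_derivative \<psi> (at z)"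
  have diff: "\<And>z. \<psi> differentiable at z" and
    cont: "continuous_on UNIV (\<lambda>z. ?D z (1, 0))" "continuous_on UNIV (\<lambda>z. ?D z (0, 1))"
    using assms by (auto simp: Basis_prod_def)
  have lin: "linear (?D z)" for z
    using frechet_derivative_works diff has_derivative_linear by blast
  have D: "?D z h = ?D z (1, 0) * fst h + ?D z (0, 1) * snd h" for z h
  proof -
    have "h = fst h *\<^sub>R (1, 0) + snd h *\<^sub>R (0, 1)"
      by (simp add: prod_eq_iff)
    then have "?D z h = ?D z (fst h *\<^sub>R (1, 0) + snd h *\<^sub>R (0, 1))"
      by simp
    also have "\<dots> = fst h *\<^sub>R ?D z (1, 0) + snd h *\<^sub>R ?D z (0, 1)"
      by (simp only: linear_add [OF lin] linear_cmul [OF lin])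
    finally show ?thesis
      by simp
  qed
  have C1: "C1_with (\<lambda>t x. \<psi> (t, x)) (\<lambda>t x. ?D (t, x) (1, 0)) (\<lambda>t x. ?D (t, x) (0, 1))"
    unfolding C1_with_def
    using diff [unfolded frechet_derivative_works] cont by (simp add: D [symmetric])
  have "deriv (\<lambda>s. \<psi> (s, x)) t = ?D (t, x) (1, 0)" for t x
    by (rule DERIV_imp_deriv) (rule C1_with_DERIV [OF C1 DERIV_ident DERIV_const], simp)
  moreover have "deriv (\<lambda>y. \<psi> (t, y)) x = ?D (t, x) (0, 1)" for t x
    by (rule DERIV_imp_deriv) (rule C1_with_DERIV [OF C1 DERIV_const DERIV_ident], simp)
  ultimately show ?thesis
    using C1 by simp
qed

text \<open>The inner integral \<open>g\<close> is the continuous derivative of \<open>m\<close>,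
  the integral of the test function against the law. As \<open>m\<close> vanishes near time 0 and
  for large times, the integral of \<open>g\<close> is 0 by the fundamental theorem of
  calculus.\<close>

lemma weak_continuity_solution_kac_law:
  assumes "a > 0" "c > 0" and v: "kac_velocity a c v"
  shows "weak_continuity_solution (kac_law a c) v"
  unfolding weak_continuity_solution_def
proof (intro allI impI)
  fix \<psi> :: "real \<times> real \<Rightarrow> real"
  assume \<psi>: "test_function \<psi>"
  define f ft fx where "f t x = \<psi> (t, x)" and "ft t x = deriv (\<lambda>s. \<psi> (s, x)) t"
    and "fx t x = deriv (\<lambda>y. \<psi> (t, y)) x" for t x
  have C1: "C1_with f ft fx"
    using Ck_1_C1_with [of \<psi>] \<psi> unfolding f_def ft_def fx_def test_function_def by blast
  define m where "m = kac_mean (a / c) c f"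
  define g where "g t = kac_mean (a / c) c ft t + kac_flux (a / c) c fx t" for t
  have m: "(m has_real_derivative g t) (at t)" for t
    unfolding m_def g_def by (rule kac_mean_has_real_derivative [OF C1])
  have "continuous_on UNIV g"
    unfolding g_def using C1 by (intro continuous_intros continuous_on_kac_mean) (auto simp: C1_with_def)
  have int: "has_bochner_integral (kac_law a c t) (continuity_integrand v \<psi> t) (g t)" if "t > 0" for t
    unfolding continuity_integrand_def [abs_def] g_def ft_def [symmetric] fx_def [symmetric]
    using that assms C1_with_continuous(2,3) [OF C1, of UNIV "\<lambda>x. t" "\<lambda>x. x"]
    by (intro has_bochner_integral_kac_law_continuity_equation) auto
  \<comment> \<open>The projection of the support to the time axis is compact in
    \<open>{0<..}\<close>, so it has a positive minimum. Without support any interval serves, here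
    \<open>{1..1}\<close>.\<close>
  obtain l u where lu: "l > 0" "\<And>t x. \<psi> (t, x) \<noteq> 0 \<Longrightarrow> t \<in> {l..u}"
  proof (cases "{p. \<psi> p \<noteq> 0} = {}")
    case True
    then show ?thesis
      using that [of 1 1] by auto
  next
    case False
    let ?S = "fst ` closure {p. \<psi> p \<noteq> 0}"
    have S: "compact ?S" "?S \<noteq> {}" "?S \<subseteq> {0<..}"
      using \<psi> False unfolding test_function_def by (auto intro!: compact_continuous_image continuous_intros)
    obtain l where "l \<in> ?S" "\<And>t. t \<in> ?S \<Longrightarrow> l \<le> t"
      using compact_attains_inf [OF S(1,2)] by blast
    moreover obtain u where "\<And>t. t \<in> ?S \<Longrightarrow> t \<le> u"
      using compact_attains_sup [OF S(1,2)] by blast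
    moreover have "\<psi> (t, x) \<noteq> 0 \<Longrightarrow> t \<in> ?S" for t x
      using closure_subset [of "{p. \<psi> p \<noteq> 0}"] by force
    ultimately show ?thesis
      using S(3) by (intro that [of l u]) auto
  qed
  have m0: "m t = 0" if "t \<notin> {l..u}" for t
  proof -
    have "f t x = 0" for x
      using lu(2) [of t x] that by (auto simp: f_def)
    then show ?thesis
      by (simp add: m_def kac_mean_def)
  qed
  \<comment> \<open>The complement of \<open>{l..u}\<close> is open and \<open>m\<close> vanishes on
    it, hence so does its derivative.\<close>
  have g0: "g t = 0" if "t \<notin> {l..u}" for t
  proof -
    have "((\<lambda>t. 0) has_real_derivative 0) (at t)"
      by simp
    moreover have "open (- {l..u})" "t \<in> - {l..u}"
      using that by auto
    ultimately have "(m has_real_derivative 0) (at t)"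
      by (rule has_field_derivative_transform_within_open) (simp add: m0)
    with m [of t] show ?thesis
      by (rule DERIV_unique)
  qed
  \<comment> \<open>The interval from \<open>l / 2\<close> to \<open>T\<close> lies in
    \<open>{0<..}\<close>, contains \<open>{l..u}\<close> and has both endpoints outside it. The
    maximum with \<open>l\<close> covers the case \<open>u < l\<close>.\<close>
  define T where "T = max (u + 1) l"
  let ?I = "{l / 2..T}"
  have sub: "?I \<subseteq> {0<..}" and I: "l / 2 \<le> T" "l / 2 \<notin> {l..u}" "T \<notin> {l..u}" and out: "t \<notin> ?I \<Longrightarrow> t \<notin> {l..u}" for t
    using \<open>l > 0\<close> by (auto simp: T_def max_def)
  have ind: "indicator {0<..} t *\<^sub>R (LINT x|kac_law a c t. continuity_integrand v \<psi> t x) = indicator ?I t *\<^sub>R g t" for t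
    using int [of t] g0 [OF out, of t] sub by (cases "t > 0") (auto simp: has_bochner_integral_iff indicator_def)
  have "set_integrable lborel ?I g"
    by (intro borel_integrable_atLeastAtMost' continuous_on_subset [OF \<open>continuous_on UNIV g\<close>]) auto
  moreover have "(LINT t:?I|lborel. g t) = integral ?I g"
    by (rule set_borel_integral_eq_integral) fact
  moreover have "integral ?I g = m T - m (l / 2)"
    using I(1) m by (intro integral_unique fundamental_theorem_of_calculus)
      (auto simp: has_real_derivative_iff_has_vector_derivative [symmetric] has_field_derivative_at_within)
  moreover have "m T - m (l / 2) = 0"
    using m0 I by simp
  ultimately show "(\<forall>t>0. integrable (kac_law a c t) (continuity_integrand v \<psi> t)) \<and>
        set_integrable lborel {0<..} (\<lambda>t. LINT x|kac_law a c t. continuity_integrand v \<psi> t x) \<and>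
        (LINT t:{0<..}|lborel. (LINT x|kac_law a c t. continuity_integrand v \<psi> t x)) = 0"
    using int unfolding set_integrable_def set_lebesgue_integral_def ind
    by (auto simp: has_bochner_integral_iff)
qed

section \<open>Paths of the Kac process\<close>

lemma set_integrable_bounded_interval:
  fixes f :: "real \<Rightarrow> real"
  assumes "f \<in> borel_measurable borel" "\<And>s. \<bar>f s\<bar> \<le> C"
  shows "set_integrable lborel {a..b} f"
  unfolding set_integrable_def
  by (rule integrableI_bounded_set [where A = "{a..b}" and B = C])
    (use assms in \<open>auto simp: emeasure_lborel_Icc_eq\<close>)

text \<open>Only measurability and regularity of the paths are required, no probability. The locale
  is therefore also available for the sigma-algebra generated by \<open>N\<close> alone, which gives
  the independence of \<open>B\<close> from functions of the path.\<close>

locale counting_paths =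
  fixes \<Omega> :: "'w measure" and N :: "real \<Rightarrow> 'w \<Rightarrow> nat"
  assumes measurable_count: "t \<ge> 0 \<Longrightarrow> N t \<in> \<Omega> \<rightarrow>\<^sub>M count_space UNIV"
    and count_0: "\<omega> \<in> space \<Omega> \<Longrightarrow> N 0 \<omega> = 0"
    and mono_count: "\<omega> \<in> space \<Omega> \<Longrightarrow> mono_on {0..} (\<lambda>t. N t \<omega>)"
    and rcont_count: "\<omega> \<in> space \<Omega> \<Longrightarrow> t \<ge> 0 \<Longrightarrow> continuous (at_right t) (\<lambda>s. N s \<omega>)"
begin

text \<open>Nothing is assumed about \<open>N\<close> at negative times, so times are clipped at 0.\<close>

definition parity :: "real \<Rightarrow> 'w \<Rightarrow> real" where
  "parity t \<omega> = (-1) ^ N (max 0 t) \<omega>"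

text \<open>The displacement for unit speed and positive initial direction; for
  \<open>t >= 0\<close> the Kac process is \<open>B * c\<close> times it.\<close>

definition travel :: "real \<Rightarrow> 'w \<Rightarrow> real" where
  "travel t \<omega> = (LINT s:{0..t}|lborel. parity s \<omega>)"

lemma abs_parity [simp]: "\<bar>parity t \<omega>\<bar> = 1"
  by (simp add: parity_def power_abs)

lemma count_le: "\<omega> \<in> space \<Omega> \<Longrightarrow> 0 \<le> s \<Longrightarrow> s \<le> t \<Longrightarrow> N s \<omega> \<le> N t \<omega>"
  using mono_onD [OF mono_count] by auto

text \<open>The values are natural numbers, so convergence from the right means being eventually
  equal to the limit.\<close>

lemma count_eq_right:
  assumes "\<omega> \<in> space \<Omega>" "t \<ge> 0"
  obtains u where "u > t" "\<And>s. t \<le> s \<Longrightarrow> s < u \<Longrightarrow> N s \<omega> = N t \<omega>"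
proof -
  have "((\<lambda>s. N s \<omega>) \<longlongrightarrow> N t \<omega>) (at_right t)"
    using rcont_count [OF assms] by (simp add: continuous_within)
  then have "eventually (\<lambda>s. N s \<omega> = N t \<omega>) (at_right t)"
    by (simp add: tendsto_discrete)
  then obtain u where "u > t" "\<And>s. t < s \<Longrightarrow> s < u \<Longrightarrow> N s \<omega> = N t \<omega>"
    by (auto simp: eventually_at_right_field)
  then show ?thesis
    by (intro that [of u]) (metis order_le_less)+
qed

text \<open>Joint measurability comes from right continuity: the path is sampled on a grid of mesh
  \<open>1 / Suc n\<close>, and each sampled function is pieced together from countably many
  measurable ones.\<close>

lemma borel_measurable_parity: "(\<lambda>(t, \<omega>). parity t \<omega>) \<in> borel_measurable (borel \<Otimes>\<^sub>M \<Omega>)"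
proof (rule borel_measurable_LIMSEQ_real)
  \<comment> \<open>The numerator \<open>Suc k\<close> selects the right end of the grid cell that
    contains \<open>max 0 t\<close>; only values to the right of a time are controlled.\<close>
  define \<tau> where "\<tau> n k = real (Suc k) / real (Suc n)" for n k
  define k where "k n t = nat \<lfloor>real (Suc n) * max 0 t\<rfloor>" for n t
  define U :: "nat \<Rightarrow> real \<times> 'w \<Rightarrow> real" where "U n z = (case z of (t, \<omega>) \<Rightarrow> (-1) ^ N (\<tau> n (k n t)) \<omega>)" for n z
  show "U n \<in> borel_measurable (borel \<Otimes>\<^sub>M \<Omega>)" for n
    unfolding U_def case_prod_beta
  proof (rule measurable_compose_countable [of "\<lambda>k z. (-1) ^ N (\<tau> n k) (snd z)" _ _ "\<lambda>z. k n (fst z)"])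
    show "(\<lambda>z. (- 1) ^ N (\<tau> n i) (snd z)) \<in> borel_measurable (borel \<Otimes>\<^sub>M \<Omega>)" for i
      by (rule measurable_compose [OF measurable_compose [OF measurable_snd measurable_count]])
        (auto simp: \<tau>_def)
    show "(\<lambda>z. k n (fst z)) \<in> (borel \<Otimes>\<^sub>M \<Omega>) \<rightarrow>\<^sub>M count_space UNIV"
      unfolding k_def by measurable
  qed
  fix z :: "real \<times> 'w"
  assume "z \<in> space (borel \<Otimes>\<^sub>M \<Omega>)"
  then obtain t \<omega> where z: "z = (t, \<omega>)" and \<omega>: "\<omega> \<in> space \<Omega>"
    by (auto simp: space_pair_measure)
  have bounds: "max 0 t \<le> \<tau> n (k n t)" "\<tau> n (k n t) \<le> max 0 t + 1 / real (Suc n)" for n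
  proof -
    have *: "real (k n t) \<le> real (Suc n) * max 0 t" "real (Suc n) * max 0 t \<le> real (k n t) + 1"
      unfolding k_def by (auto simp: of_nat_nat intro!: mult_nonneg_nonneg)
    show "max 0 t \<le> \<tau> n (k n t)"
    proof -
      have "max 0 t * real (Suc n) \<le> real (Suc (k n t))"
        using *(2) unfolding mult.commute [of "max 0 t"] of_nat_Suc [of "k n t"] by linarith
      then show ?thesis
        unfolding \<tau>_def by (subst pos_le_divide_eq) auto
    qed
    have "real (k n t) / real (Suc n) \<le> max 0 t"
      using *(1) by (simp add: pos_divide_le_eq mult.commute)
    then show "\<tau> n (k n t) \<le> max 0 t + 1 / real (Suc n)"
      unfolding \<tau>_def by (simp add: add_divide_distrib)
  qed
  obtain u where u: "u > max 0 t" "\<And>s. max 0 t \<le> s \<Longrightarrow> s < u \<Longrightarrow> N s \<omega> = N (max 0 t) \<omega>"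
    using count_eq_right [OF \<omega>, of "max 0 t"] by auto
  have "(\<lambda>n. max 0 t + 1 / real (Suc n)) \<longlonglongrightarrow> max 0 t + 0"
    by (intro tendsto_intros LIMSEQ_Suc [OF lim_1_over_n])
  with u(1) have "eventually (\<lambda>n. max 0 t + 1 / real (Suc n) < u) sequentially"
    by (intro order_tendstoD(2)) auto
  then have "eventually (\<lambda>n. U n z = parity t \<omega>) sequentially"
  proof eventually_elim
    case (elim n)
    then have "N (\<tau> n (k n t)) \<omega> = N (max 0 t) \<omega>"
      using bounds [of n] by (intro u(2)) auto
    then show ?case
      by (simp add: U_def z parity_def)
  qed
  then show "(\<lambda>n. U n z) \<longlonglongrightarrow> (case z of (t, \<omega>) \<Rightarrow> parity t \<omega>)"
    unfolding z prod.case by (rule tendsto_eventually)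
qed

lemma measurable_parity [measurable]:
  "p \<in> borel_measurable A \<Longrightarrow> q \<in> A \<rightarrow>\<^sub>M \<Omega> \<Longrightarrow> (\<lambda>x. parity (p x) (q x)) \<in> borel_measurable A"
  using measurable_compose [OF measurable_Pair borel_measurable_parity] by simp

lemma borel_measurable_travel: "(\<lambda>(t, \<omega>). travel t \<omega>) \<in> borel_measurable (borel \<Otimes>\<^sub>M \<Omega>)"
proof -
  have "(\<lambda>x. indicat_real {0..fst (fst x)} (snd x) *\<^sub>R parity (snd x) (snd (fst x)))
      \<in> borel_measurable ((borel \<Otimes>\<^sub>M \<Omega>) \<Otimes>\<^sub>M lborel)"
    unfolding indicator_def atLeastAtMost_iff by measurable
  then show ?thesis
    unfolding travel_def set_lebesgue_integral_def case_prod_beta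
    by (intro lborel.borel_measurable_lebesgue_integral) (simp add: case_prod_beta)
qed

lemma measurable_travel [measurable]:
  "p \<in> borel_measurable A \<Longrightarrow> q \<in> A \<rightarrow>\<^sub>M \<Omega> \<Longrightarrow> (\<lambda>x. travel (p x) (q x)) \<in> borel_measurable A"
  using measurable_compose [OF measurable_Pair borel_measurable_travel] by simp

lemma measurable_travel_fixed [measurable]:
  assumes "\<omega> \<in> space \<Omega>"
  shows "(\<lambda>s. parity s \<omega>) \<in> borel_measurable borel" "(\<lambda>s. travel s \<omega>) \<in> borel_measurable borel"
  using assms by measurable

lemma
  assumes "\<omega> \<in> space \<Omega>"
  shows parity_integrable_on: "(\<lambda>s. parity s \<omega>) integrable_on {a..b}"
    and travel_eq_integral: "travel t \<omega> = integral {0..t} (\<lambda>s. parity s \<omega>)"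
proof -
  have *: "set_integrable lborel {a..b} (\<lambda>s. parity s \<omega>)" for a b
    by (rule set_integrable_bounded_interval [where C = 1]) (simp_all add: assms)
  show "(\<lambda>s. parity s \<omega>) integrable_on {a..b}"
    by (rule set_borel_integral_eq_integral [OF *])
  show "travel t \<omega> = integral {0..t} (\<lambda>s. parity s \<omega>)"
    unfolding travel_def by (rule set_borel_integral_eq_integral [OF *])
qed

lemma travel_0: "travel 0 \<omega> = 0" if "\<omega> \<in> space \<Omega>"
  by (simp add: travel_eq_integral [OF that])

section \<open>Differentiation along a path\<close>

lemma count_locally_constant:
  assumes \<omega>: "\<omega> \<in> space \<Omega>" and "s > 0"
    and jump: "s \<noteq> Inf {u. u \<ge> 0 \<and> N u \<omega> \<ge> N s \<omega>}"
  obtains l u where "0 \<le> l" "l < s" "s < u" "\<And>r. r \<in> {l<..<u} \<Longrightarrow> N r \<omega> = N s \<omega>"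
proof -
  let ?A = "{u. u \<ge> 0 \<and> N u \<omega> \<ge> N s \<omega>}"
  have "bdd_below ?A"
    by (rule bdd_belowI [of _ 0]) simp
  moreover have "s \<in> ?A"
    using \<open>s > 0\<close> by simp
  ultimately have "Inf ?A \<le> s"
    by (intro cInf_lower)
  with jump have "Inf ?A < s"
    by (metis order_le_less)
  \<comment> \<open>The infimum is the first time at which the path reaches the level
    \<open>N s \<omega>\<close>. As \<open>s\<close> comes later, this level is already reached at
    some \<open>l < s\<close>, and monotonicity freezes the count between \<open>l\<close> and
    \<open>s\<close>.\<close>
  then obtain l where l: "l \<in> ?A" "l < s"
    using cInf_lessD [of ?A s] \<open>s \<in> ?A\<close> by blast
  obtain u where u: "u > s" "\<And>r. s \<le> r \<Longrightarrow> r < u \<Longrightarrow> N r \<omega> = N s \<omega>"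
    by (rule count_eq_right [OF \<omega> less_imp_le [OF \<open>s > 0\<close>]], rule that)
  show ?thesis
  proof (rule that)
    show "0 \<le> l" "l < s" "s < u"
      using l u(1) by auto
    fix r assume r: "r \<in> {l<..<u}"
    show "N r \<omega> = N s \<omega>"
    proof (cases "r \<le> s")
      case True
      then have "N l \<omega> \<le> N r \<omega>" "N r \<omega> \<le> N s \<omega>"
        using r l by (auto intro!: count_le \<omega>)
      with l show ?thesis
        by simp
    next
      case False
      with r show ?thesis
        by (intro u(2)) auto
    qed
  qed
qed

lemma travel_has_real_derivative:
  assumes \<omega>: "\<omega> \<in> space \<Omega>" and "s > 0"
    and jump: "s \<noteq> Inf {u. u \<ge> 0 \<and> N u \<omega> \<ge> N s \<omega>}"
  shows "((\<lambda>t. travel t \<omega>) has_real_derivative parity s \<omega>) (at s)"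
proof -
  obtain l u where lu: "0 \<le> l" "l < s" "s < u" "\<And>r. r \<in> {l<..<u} \<Longrightarrow> N r \<omega> = N s \<omega>"
    by (rule count_locally_constant [OF assms], rule that)
  have "continuous (at s) (\<lambda>r. parity r \<omega>)"
    unfolding isCont_def
  proof (rule tendsto_eventually)
    have "eventually (\<lambda>r. r \<in> {l<..<u}) (at s)"
      using lu(2,3) by (intro eventually_at_in_open') auto
    then show "eventually (\<lambda>r. parity r \<omega> = parity s \<omega>) (at s)"
    proof eventually_elim
      case (elim r)
      with lu(4) [OF this] lu(1) \<open>s > 0\<close> show ?case
        by (simp add: parity_def)
    qed
  qed
  then have "((\<lambda>t. integral {0..t} (\<lambda>s. parity s \<omega>)) has_vector_derivative parity s \<omega>) (at s within ({0..s + 1} - {}))"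
    using \<open>s > 0\<close>
    by (intro integral_has_vector_derivative_continuous_at parity_integrable_on [OF \<omega>])
      (auto intro: continuous_at_imp_continuous_at_within)
  moreover have "at s within ({0..s + 1} - {}) = at s"
    using \<open>s > 0\<close> by (intro at_within_interior) auto
  ultimately show ?thesis
    unfolding travel_eq_integral [OF \<omega>] by (simp only: has_real_derivative_iff_has_vector_derivative)
qed

lemma continuous_on_travel: "\<omega> \<in> space \<Omega> \<Longrightarrow> continuous_on {0..t} (\<lambda>s. travel s \<omega>)"
  by (subst travel_eq_integral, assumption) (intro indefinite_integral_continuous_1 parity_integrable_on)

text \<open>Chain rule along a path. The path is differentiable except at finitely many times, which
  the fundamental theorem of calculus tolerates; the bound \<open>C\<close> serves to pass from the
  gauge integral to the Lebesgue integral.\<close>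

lemma travel_FTC:
  assumes \<omega>: "\<omega> \<in> space \<Omega>" and "t \<ge> 0"
    and G: "\<And>x. (G has_real_derivative g x) (at x)" and g: "continuous_on UNIV g" "\<And>x. \<bar>g x\<bar> \<le> C"
  shows "(LINT s:{0..t}|lborel. parity s \<omega> * g (travel s \<omega>)) = G (travel t \<omega>) - G 0"
proof -
  \<comment> \<open>The first hitting times of the levels up to \<open>N t \<omega>\<close>; every
    jump in the open interval is one of them.\<close>
  let ?S = "(\<lambda>k. Inf {u. u \<ge> 0 \<and> N u \<omega> \<ge> k}) ` {..N t \<omega>}"
  have "((\<lambda>s. parity s \<omega> * g (travel s \<omega>)) has_integral G (travel t \<omega>) - G (travel 0 \<omega>)) {0..t}"
  proof (rule fundamental_theorem_of_calculus_interior_strong)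
    show "finite ?S"
      by simp
    have "continuous_on UNIV G"
      using G by (intro DERIV_continuous_on) (auto intro: has_field_derivative_at_within)
    then show "continuous_on {0..t} (\<lambda>s. G (travel s \<omega>))"
      by (rule continuous_on_compose2 [OF _ continuous_on_travel [OF \<omega>]]) auto
    fix s assume s: "s \<in> {0<..<t} - ?S"
    then have "N s \<omega> \<in> {..N t \<omega>}"
      using \<open>t \<ge> 0\<close> by (auto intro!: count_le \<omega>)
    with s have "s \<noteq> Inf {u. u \<ge> 0 \<and> N u \<omega> \<ge> N s \<omega>}"
      by blast
    with s have "((\<lambda>t. travel t \<omega>) has_real_derivative parity s \<omega>) (at s)"
      by (intro travel_has_real_derivative \<omega>) auto
    from DERIV_chain2 [OF G this]
    show "((\<lambda>s. G (travel s \<omega>)) has_vector_derivative parity s \<omega> * g (travel s \<omega>)) (at s)"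
      by (simp add: has_real_derivative_iff_has_vector_derivative mult.commute)
  qed (use \<open>t \<ge> 0\<close> in auto)
  moreover have "(LINT s:{0..t}|lborel. parity s \<omega> * g (travel s \<omega>)) = integral {0..t} (\<lambda>s. parity s \<omega> * g (travel s \<omega>))"
    using g by (intro set_borel_integral_eq_integral set_integrable_bounded_interval [where C = C]
        borel_measurable_times measurable_compose [OF measurable_travel_fixed(2) [OF \<omega>]] measurable_travel_fixed \<omega>
        borel_measurable_continuous_onI) (auto simp: abs_mult)
  ultimately show ?thesis
    by (simp add: integral_unique travel_0 [OF \<omega>])
qed

section \<open>Riemann sums along a path\<close>

text \<open>Only subintervals containing a jump contribute to the error, and the jumps telescope.\<close>

lemma travel_Riemann_sum:
  assumes \<omega>: "\<omega> \<in> space \<Omega>" and "d \<ge> 0"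
  shows "\<bar>travel (d * real m) \<omega> - (\<Sum>k<m. d * parity (d * real (Suc k)) \<omega>)\<bar> \<le> 2 * d * N (d * real m) \<omega>"
proof (induction m)
  case 0
  then show ?case
    by (simp add: travel_0 count_0 \<omega>)
next
  case (Suc m)
  let ?a = "d * real m" and ?b = "d * real (Suc m)"
  let ?I = "integral {?a..?b} (\<lambda>s. parity s \<omega>)"
  have ab: "0 \<le> ?a" "?a \<le> ?b" "?b - ?a = d"
    using \<open>d \<ge> 0\<close> by (auto simp: algebra_simps)
  have "travel ?b \<omega> = travel ?a \<omega> + ?I"
    unfolding travel_eq_integral [OF \<omega>]
    by (intro Henstock_Kurzweil_Integration.integral_combine [symmetric] parity_integrable_on \<omega> ab)
  moreover have "\<bar>?I - d * parity ?b \<omega>\<bar> \<le> 2 * d * (real (N ?b \<omega>) - real (N ?a \<omega>))"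
  proof (cases "N ?a \<omega> = N ?b \<omega>")
    case True
    have const: "parity s \<omega> = parity ?b \<omega>" if "s \<in> {?a..?b}" for s
    proof -
      have "0 \<le> s"
        using that ab(1) by (meson atLeastAtMost_iff order_trans)
      have "N ?a \<omega> \<le> N s \<omega>" "N s \<omega> \<le> N ?b \<omega>"
        using that ab(1) \<open>0 \<le> s\<close> by (auto intro!: count_le \<omega> simp del: of_nat_Suc)
      with True show ?thesis
        using \<open>0 \<le> s\<close> ab(1,2) by (simp add: parity_def max_absorb2 del: of_nat_Suc)
    qed
    have "?I = integral {?a..?b} (\<lambda>s. parity ?b \<omega>)"
      by (rule Henstock_Kurzweil_Integration.integral_cong) (rule const)
    also have "\<dots> = d * parity ?b \<omega>"
      using ab by simp
    finally show ?thesis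
      using True by simp
  next
    \<comment> \<open>On a cell with a jump, the integral and the sampled term are both at most
      \<open>d\<close> in absolute value, so the error \<open>2 * d\<close> is covered by an
      increment of at least 1.\<close>
    case False
    have "N ?a \<omega> \<le> N ?b \<omega>"
      using ab by (auto intro!: count_le \<omega> simp del: of_nat_Suc)
    with False have 1: "1 \<le> real (N ?b \<omega>) - real (N ?a \<omega>)"
      by linarith
    have "norm ?I \<le> 1 * measure lborel {?a..?b}"
      by (rule has_integral_bound_real [OF _ finite.emptyI integrable_integral [OF parity_integrable_on [OF \<omega>]]])
        auto
    then have "\<bar>?I\<bar> \<le> d"
      unfolding content_real [OF ab(2)] ab(3) by simp
    moreover have "\<bar>d * parity ?b \<omega>\<bar> \<le> d"
      using \<open>d \<ge> 0\<close> by (simp add: abs_mult)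
    ultimately have "\<bar>?I - d * parity ?b \<omega>\<bar> \<le> 2 * d * 1"
      by linarith
    also have "\<dots> \<le> 2 * d * (real (N ?b \<omega>) - real (N ?a \<omega>))"
      using 1 \<open>d \<ge> 0\<close> by (intro mult_left_mono) auto
    finally show ?thesis .
  qed
  ultimately show ?case
    using Suc.IH by (simp add: algebra_simps)
qed

text \<open>The error is at most \<open>2 * t / n\<close> times the fixed number
  \<open>N t \<omega>\<close>.\<close>

lemma travel_Riemann_sum_LIMSEQ:
  assumes \<omega>: "\<omega> \<in> space \<Omega>" and "t \<ge> 0"
  shows "(\<lambda>n. \<Sum>k<n. t / n * parity (t / n * real (Suc k)) \<omega>) \<longlonglongrightarrow> travel t \<omega>"
proof (rule Lim_transform2)
  show "(\<lambda>n. travel t \<omega>) \<longlonglongrightarrow> travel t \<omega>"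
    by simp
  show "(\<lambda>n. travel t \<omega> - (\<Sum>k<n. t / n * parity (t / n * real (Suc k)) \<omega>)) \<longlonglongrightarrow> 0"
  proof (rule Lim_null_comparison)
    show "eventually (\<lambda>n. norm (travel t \<omega> - (\<Sum>k<n. t / n * parity (t / n * real (Suc k)) \<omega>)) \<le> 2 * t * N t \<omega> * (1 / n)) sequentially"
      using eventually_gt_at_top [of 0]
    proof eventually_elim
      case (elim n)
      then have "t / n * n = t"
        by simp
      with travel_Riemann_sum [OF \<omega>, of "t / n" n] \<open>t \<ge> 0\<close> show ?case
        by simp
    qed
    show "(\<lambda>n. 2 * t * N t \<omega> * (1 / real n)) \<longlonglongrightarrow> 0"
      using tendsto_mult_right_zero [OF lim_1_over_n] by blast
  qed
qed

end

section \<open>The law of the Kac process\<close>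

text \<open>The generating function of the Poisson distribution at -1: the series is
  \<open>exp (- r)\<close> times the exponential series at \<open>- r\<close>.\<close>

lemma expectation_parity_poisson:
  assumes "r > 0"
  shows "measure_pmf.expectation (poisson_pmf r) (\<lambda>n. (-1) ^ n) = exp (- 2 * r)"
proof -
  have sums: "(\<lambda>n. pmf (poisson_pmf r) n * (-1) ^ n) sums (exp (- r) * exp (- r))"
  proof -
    have "(\<lambda>n. exp (- r) * ((- r) ^ n /\<^sub>R fact n)) sums (exp (- r) * exp (- r))"
      by (intro sums_mult exp_converges)
    also have "(\<lambda>n. exp (- r) * ((- r) ^ n /\<^sub>R fact n)) = (\<lambda>n. pmf (poisson_pmf r) n * (-1) ^ n)"
      using assms by (auto simp: fun_eq_iff power_minus [of r] divide_inverse)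
    finally show ?thesis .
  qed
  have "summable (\<lambda>n. norm (pmf (poisson_pmf r) n * (-1) ^ n))"
  proof -
    have "summable (\<lambda>n. exp (- r) * (r ^ n /\<^sub>R fact n))"
      by (intro summable_mult sums_summable [OF exp_converges])
    then show ?thesis
      using assms by (simp add: abs_mult power_abs divide_inverse ac_simps)
  qed
  then have "integrable (count_space UNIV) (\<lambda>n. pmf (poisson_pmf r) n * (-1) ^ n)"
    by (simp add: integrable_count_space_nat_iff)
  then have "integral\<^sup>L (count_space UNIV) (\<lambda>n. pmf (poisson_pmf r) n * (-1) ^ n) = exp (- r) * exp (- r)"
    using sums by (simp only: integral_count_space_nat sums_unique [symmetric])
  then show ?thesis
    unfolding measure_pmf_eq_density
    by (subst integral_density) (auto simp: mult_exp_exp)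
qed

section \<open>Independence of the increments and the path up to a given time\<close>

locale poisson_paths = prob_space M + counting_paths M N for M :: "'w measure" and N +
  fixes a :: real
  assumes rate_pos: "a > 0"
    and distr_increment: "0 \<le> s \<Longrightarrow> s < t \<Longrightarrow>
      distr M (count_space UNIV) (\<lambda>\<omega>. N t \<omega> - N s \<omega>) = measure_pmf (poisson_pmf (a * (t - s)))"
    and indep_increments: "0 \<le> \<tau> 0 \<Longrightarrow> (\<And>i. i < n \<Longrightarrow> \<tau> i < \<tau> (Suc i)) \<Longrightarrow>
      indep_vars (\<lambda>_. count_space UNIV) (\<lambda>i \<omega>. N (\<tau> (Suc i)) \<omega> - N (\<tau> i) \<omega>) {..<n::nat}"
begin

lemma parity_increment:
  assumes "\<omega> \<in> space M" "0 \<le> s" "s \<le> t"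
  shows "parity t \<omega> = parity s \<omega> * (-1) ^ (N t \<omega> - N s \<omega>)"
  using count_le [OF assms] assms by (simp add: parity_def power_add [symmetric])

lemma parity_mult_parity:
  assumes "\<omega> \<in> space M" "0 \<le> s" "s \<le> t"
  shows "parity t \<omega> * parity s \<omega> = (-1) ^ (N t \<omega> - N s \<omega>)"
proof -
  have "parity t \<omega> * parity s \<omega> = parity s \<omega> * parity s \<omega> * (-1) ^ (N t \<omega> - N s \<omega>)"
    unfolding parity_increment [OF assms] by (simp only: ac_simps)
  also have "parity s \<omega> * parity s \<omega> = 1"
    by (metis abs_mult_self_eq abs_parity mult_1)
  finally show ?thesis
    by simp
qed

lemma expectation_parity_mult_parity:
  assumes "0 \<le> s" "s < t"
  shows "expectation (\<lambda>\<omega>. parity t \<omega> * parity s \<omega>) = exp (- 2 * a * (t - s))"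
proof -
  have [measurable]: "N t \<in> M \<rightarrow>\<^sub>M count_space UNIV" "N s \<in> M \<rightarrow>\<^sub>M count_space UNIV"
    using assms by (auto intro!: measurable_count)
  have "expectation (\<lambda>\<omega>. parity t \<omega> * parity s \<omega>) = expectation (\<lambda>\<omega>. (-1) ^ (N t \<omega> - N s \<omega>))"
    using assms by (intro Bochner_Integration.integral_cong refl parity_mult_parity) auto
  also have "\<dots> = integral\<^sup>L (distr M (count_space UNIV) (\<lambda>\<omega>. N t \<omega> - N s \<omega>)) (\<lambda>n. (-1) ^ n)"
    by (subst integral_distr) auto
  also have "\<dots> = exp (- 2 * (a * (t - s)))"
    unfolding distr_increment [OF assms]
    using assms rate_pos by (intro expectation_parity_poisson) auto
  finally show ?thesis
    by (simp add: mult.assoc)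
qed

text \<open>The Riemann sum on the interval from 0 to \<open>s\<close> depends on the first
  \<open>n\<close> increments only, whereas the product of the parities at \<open>t\<close> and
  \<open>s\<close> is the sign of the increment over the interval from \<open>s\<close> to
  \<open>t\<close>. Independence factorizes the expectation.\<close>

lemma expectation_parity_mult_Riemann_sum:
  fixes F :: "real \<Rightarrow> real"
  assumes "0 < s" "s < t" and F: "F \<in> borel_measurable borel" "\<And>x. \<bar>F x\<bar> \<le> C" and "n > 0"
  defines "R \<equiv> \<lambda>\<omega>. \<Sum>k<n. s / n * parity (s / n * real (Suc k)) \<omega>"
  shows "expectation (\<lambda>\<omega>. parity t \<omega> * parity s \<omega> * F (R \<omega>)) =
    exp (- 2 * a * (t - s)) * expectation (\<lambda>\<omega>. F (R \<omega>))"
proof -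
  \<comment> \<open>The grid has \<open>n\<close> equal cells up to \<open>\<tau> n = s\<close> and
    one further cell ending at \<open>\<tau> (Suc n) = t\<close>.\<close>
  define \<tau> where "\<tau> i = (if i \<le> n then s / n * real i else t)" for i
  define D where "D i \<omega> = N (\<tau> (Suc i)) \<omega> - N (\<tau> i) \<omega>" for i \<omega>
  \<comment> \<open>The Riemann sum as a function of the increments: since the count starts at 0,
    the parity at a grid time is the product of the signs of the increments before it.\<close>
  define G where "G x = F (\<Sum>k<n. s / n * (\<Prod>i<Suc k. (-1) ^ x i))" for x :: "nat \<Rightarrow> nat"
  have \<tau>: "\<tau> 0 = 0" "\<tau> n = s" "\<tau> (Suc n) = t"
    using \<open>n > 0\<close> by (auto simp: \<tau>_def)
  have mono: "\<tau> i < \<tau> (Suc i)" if "i < Suc n" for i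
  proof (cases "i = n")
    case True
    then show ?thesis
      using \<tau> \<open>s < t\<close> by simp
  next
    case False
    with that \<open>n > 0\<close> \<open>0 < s\<close> show ?thesis
      by (simp add: \<tau>_def divide_strict_right_mono)
  qed
  have ge0: "\<tau> i \<ge> 0" if "i \<le> Suc n" for i
    using assms by (simp add: \<tau>_def)
  have par: "parity (s / n * real k) \<omega> = (\<Prod>i<k. (-1) ^ D i \<omega>)" if "k \<le> n" "\<omega> \<in> space M" for k \<omega>
    using that
  proof (induction k)
    case 0
    then show ?case
      by (simp add: parity_def count_0)
  next
    case (Suc k)
    have "s / n * real k = \<tau> k" "s / n * real (Suc k) = \<tau> (Suc k)"
      using Suc.prems by (simp_all add: \<tau>_def)
    moreover have "parity (\<tau> (Suc k)) \<omega> = parity (\<tau> k) \<omega> * (-1) ^ D k \<omega>"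
      unfolding D_def using Suc.prems mono [of k] ge0 [of k] by (intro parity_increment) auto
    ultimately show ?case
      using Suc by simp
  qed
  have "indep_vars (\<lambda>_. count_space UNIV) D {..<Suc n}"
    unfolding D_def [abs_def] using mono \<tau>(1) by (intro indep_increments) auto
  then have "indep_var (PiM {n} (\<lambda>_. count_space UNIV)) (\<lambda>\<omega>. \<lambda>i\<in>{n}. D i \<omega>)
      (PiM {..<n} (\<lambda>_. count_space UNIV)) (\<lambda>\<omega>. \<lambda>i\<in>{..<n}. D i \<omega>)"
    by (rule indep_var_restrict) auto
  then have "indep_var borel ((\<lambda>x. (-1) ^ x n :: real) \<circ> (\<lambda>\<omega>. \<lambda>i\<in>{n}. D i \<omega>)) borel (G \<circ> (\<lambda>\<omega>. \<lambda>i\<in>{..<n}. D i \<omega>))"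
  proof (rule indep_var_compose)
    have comp: "(\<lambda>x. (-1) ^ x i :: real) \<in> borel_measurable (PiM I (\<lambda>_. count_space UNIV))" if "i \<in> I" for I and i :: nat
      by (rule measurable_compose [OF measurable_component_singleton [OF that]]) simp
    show "(\<lambda>x. (-1) ^ x n :: real) \<in> borel_measurable (PiM {n} (\<lambda>_. count_space UNIV))"
      by (rule comp) simp
    show "G \<in> borel_measurable (PiM {..<n} (\<lambda>_. count_space UNIV))"
      unfolding G_def
      by (intro measurable_compose [OF _ F(1)] borel_measurable_sum borel_measurable_times borel_measurable_const
          borel_measurable_prod comp) auto
  qed
  moreover have "(\<lambda>x. (-1) ^ x n :: real) \<circ> (\<lambda>\<omega>. \<lambda>i\<in>{n}. D i \<omega>) = (\<lambda>\<omega>. (-1) ^ D n \<omega>)"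
    by auto
  moreover have "G \<circ> (\<lambda>\<omega>. \<lambda>i\<in>{..<n}. D i \<omega>) = (\<lambda>\<omega>. G (\<lambda>i. D i \<omega>))"
    unfolding G_def comp_def by (intro ext arg_cong [where f = F] sum.cong refl arg_cong2 [where f = "(*)"] prod.cong) auto
  ultimately have ind: "indep_var borel (\<lambda>\<omega>. (-1) ^ D n \<omega> :: real) borel (\<lambda>\<omega>. G (\<lambda>i. D i \<omega>))"
    by simp
  have G: "G (\<lambda>i. D i \<omega>) = F (R \<omega>)" if "\<omega> \<in> space M" for \<omega>
    unfolding G_def R_def using that
    by (intro arg_cong [where f = F] sum.cong refl arg_cong2 [where f = "(*)"] par [symmetric]) auto
  have pD: "parity t \<omega> * parity s \<omega> = (-1) ^ D n \<omega>" if "\<omega> \<in> space M" for \<omega>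
    unfolding D_def \<tau> using assms that by (intro parity_mult_parity) auto
  have "integrable M (\<lambda>\<omega>. (-1) ^ D n \<omega> :: real)"
    using indep_var_rv1 [OF ind] by (intro integrable_const_bound [where B = 1]) (simp_all add: power_abs)
  moreover have "integrable M (\<lambda>\<omega>. G (\<lambda>i. D i \<omega>))"
    using indep_var_rv2 [OF ind] by (intro integrable_const_bound [where B = C]) (simp_all add: G_def F(2))
  ultimately have int: "integrable M (\<lambda>\<omega>. (-1) ^ D n \<omega> :: real)" "integrable M (\<lambda>\<omega>. G (\<lambda>i. D i \<omega>))" .
  have "expectation (\<lambda>\<omega>. parity t \<omega> * parity s \<omega> * F (R \<omega>)) = expectation (\<lambda>\<omega>. (-1) ^ D n \<omega> * G (\<lambda>i. D i \<omega>))"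
    by (intro Bochner_Integration.integral_cong refl) (simp add: G pD)
  also have "\<dots> = expectation (\<lambda>\<omega>. (-1) ^ D n \<omega>) * expectation (\<lambda>\<omega>. G (\<lambda>i. D i \<omega>))"
    by (rule indep_var_lebesgue_integral [OF ind int])
  also have "expectation (\<lambda>\<omega>. (-1) ^ D n \<omega>) = expectation (\<lambda>\<omega>. parity t \<omega> * parity s \<omega>)"
    by (intro Bochner_Integration.integral_cong refl) (simp add: pD)
  also have "\<dots> = exp (- 2 * a * (t - s))"
    using assms by (intro expectation_parity_mult_parity) auto
  also have "expectation (\<lambda>\<omega>. G (\<lambda>i. D i \<omega>)) = expectation (\<lambda>\<omega>. F (R \<omega>))"
    by (intro Bochner_Integration.integral_cong refl) (simp add: G)
  finally show ?thesis .
qed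

text \<open>Dominated convergence carries the factorization from the Riemann sums to
  \<open>travel\<close>.\<close>

lemma expectation_parity_mult_travel:
  fixes F :: "real \<Rightarrow> real"
  assumes "0 < s" "s < t" and F: "continuous_on UNIV F" "\<And>x. \<bar>F x\<bar> \<le> C"
  shows "expectation (\<lambda>\<omega>. parity t \<omega> * parity s \<omega> * F (travel s \<omega>)) =
    exp (- 2 * a * (t - s)) * expectation (\<lambda>\<omega>. F (travel s \<omega>))"
proof -
  define R where "R n \<omega> = (\<Sum>k<n. s / real n * parity (s / real n * real (Suc k)) \<omega>)" for n \<omega>
  have [measurable]: "F \<in> borel_measurable borel"
    using F(1) by (rule borel_measurable_continuous_onI)
  have [measurable]: "R n \<in> borel_measurable M" for n
    unfolding R_def by measurable
  have lim: "(\<lambda>n. F (R n \<omega>)) \<longlonglongrightarrow> F (travel s \<omega>)" if "\<omega> \<in> space M" for \<omega>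
  proof -
    have "(\<lambda>n. R n \<omega>) \<longlonglongrightarrow> travel s \<omega>"
      unfolding R_def using travel_Riemann_sum_LIMSEQ [OF that, of s] \<open>0 < s\<close> by simp
    then show ?thesis
      using F(1) continuous_on_tendsto_compose [of UNIV F] by auto
  qed
  have "(\<lambda>n. expectation (\<lambda>\<omega>. parity t \<omega> * parity s \<omega> * F (R n \<omega>))) \<longlonglongrightarrow>
      expectation (\<lambda>\<omega>. parity t \<omega> * parity s \<omega> * F (travel s \<omega>))"
    by (rule integral_dominated_convergence [where w = "\<lambda>_. C"])
      (use lim F(2) in \<open>auto intro!: tendsto_intros simp: abs_mult\<close>)
  moreover have 2: "(\<lambda>n. exp (- 2 * a * (t - s)) * expectation (\<lambda>\<omega>. F (R n \<omega>))) \<longlonglongrightarrow>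
      exp (- 2 * a * (t - s)) * expectation (\<lambda>\<omega>. F (travel s \<omega>))"
    by (intro tendsto_mult_left integral_dominated_convergence [where w = "\<lambda>_. C"])
      (use lim F(2) in auto)
  moreover have "eventually (\<lambda>n. expectation (\<lambda>\<omega>. parity t \<omega> * parity s \<omega> * F (R n \<omega>)) =
      exp (- 2 * a * (t - s)) * expectation (\<lambda>\<omega>. F (R n \<omega>))) sequentially"
    using eventually_gt_at_top [of 0]
  proof eventually_elim
    case (elim n)
    then show ?case
      unfolding R_def using assms by (intro expectation_parity_mult_Riemann_sum) auto
  qed
  ultimately have "(\<lambda>n. exp (- 2 * a * (t - s)) * expectation (\<lambda>\<omega>. F (R n \<omega>))) \<longlonglongrightarrow>
      expectation (\<lambda>\<omega>. parity t \<omega> * parity s \<omega> * F (travel s \<omega>))"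
    by (simp only: tendsto_cong)
  then show ?thesis
    using 2 by (rule LIMSEQ_unique)
qed

lemma
  fixes f :: "real \<Rightarrow> 'w \<Rightarrow> real"
  assumes f: "(\<lambda>z. f (fst z) (snd z)) \<in> borel_measurable (borel \<Otimes>\<^sub>M M)" "\<And>s \<omega>. \<bar>f s \<omega>\<bar> \<le> C"
  shows set_integrable_expectation: "set_integrable lborel {0..t} (\<lambda>s. expectation (f s))"
    and expectation_set_integral: "expectation (\<lambda>\<omega>. LINT s:{0..t}|lborel. f s \<omega>) = (LINT s:{0..t}|lborel. expectation (f s))"
proof -
  interpret P: pair_sigma_finite lborel M ..
  have "sets (lborel \<Otimes>\<^sub>M M) = sets (borel \<Otimes>\<^sub>M M)"
    by (intro sets_pair_measure_cong) auto
  then have [measurable]: "(\<lambda>z. f (fst z) (snd z)) \<in> borel_measurable (lborel \<Otimes>\<^sub>M M)"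
    using f(1) by (simp cong: measurable_cong_sets)
  have int: "integrable (lborel \<Otimes>\<^sub>M M) (\<lambda>(s, \<omega>). indicator {0..t} s *\<^sub>R f s \<omega>)"
  proof (rule integrableI_bounded_set [where A = "{0..t} \<times> space M" and B = C])
    show "emeasure (lborel \<Otimes>\<^sub>M M) ({0..t} \<times> space M) < \<infinity>"
      by (subst emeasure_pair_measure_Times) (auto simp: emeasure_lborel_Icc_eq emeasure_space_1)
  qed (use f(2) in \<open>auto simp: case_prod_beta space_pair_measure indicator_def split: if_splits intro!: AE_I2\<close>)
  show "set_integrable lborel {0..t} (\<lambda>s. expectation (f s))"
    using P.integrable_fst' [OF int] by (simp add: set_integrable_def)
  show "expectation (\<lambda>\<omega>. LINT s:{0..t}|lborel. f s \<omega>) = (LINT s:{0..t}|lborel. expectation (f s))"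
    using P.Fubini_integral [OF int] by (simp add: set_lebesgue_integral_def)
qed

section \<open>The telegraph system along the process\<close>

definition mean_cos :: "real \<Rightarrow> real \<Rightarrow> real" where
  "mean_cos k t = expectation (\<lambda>\<omega>. cos (k * travel t \<omega>))"

text \<open>At frequency \<open>k * c\<close>, and up to the factor \<open>c\<close>, this is the
  expectation of the velocity times the sine of \<open>k\<close> times the Kac process; the sign
  \<open>B\<close> occurs twice and cancels.\<close>

definition mean_parity_sin :: "real \<Rightarrow> real \<Rightarrow> real" where
  "mean_parity_sin k t = expectation (\<lambda>\<omega>. parity t \<omega> * sin (k * travel t \<omega>))"

text \<open>The chain rule along the path, followed by Fubini. The integrated form comes first
  because continuity is bootstrapped: it gives continuity of \<open>mean_cos\<close>, then that of
  \<open>mean_parity_sin\<close>, and only then the differential equations.\<close>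

lemma mean_cos_eq:
  assumes "t \<ge> 0"
  shows "mean_cos k t = 1 - k * integral {0..t} (mean_parity_sin k)"
    and "mean_parity_sin k integrable_on {0..t}"
proof -
  let ?f = "\<lambda>s \<omega>. parity s \<omega> * sin (k * travel s \<omega>)"
  have bound: "\<bar>?f s \<omega>\<bar> \<le> 1" for s \<omega>
    by (simp add: abs_mult)
  have meas: "(\<lambda>z. ?f (fst z) (snd z)) \<in> borel_measurable (borel \<Otimes>\<^sub>M M)"
    by measurable
  note int = set_integrable_expectation [OF meas bound, of t, folded mean_parity_sin_def]
  show "mean_parity_sin k integrable_on {0..t}"
    using set_borel_integral_eq_integral(1) [OF int] .
  have "cos (k * travel t \<omega>) = 1 - k * (LINT s:{0..t}|lborel. ?f s \<omega>)" if "\<omega> \<in> space M" for \<omega>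
  proof -
    have "(LINT s:{0..t}|lborel. parity s \<omega> * (- k * sin (k * travel s \<omega>))) = cos (k * travel t \<omega>) - cos (k * 0)"
      by (rule travel_FTC [OF that assms, where C = "\<bar>k\<bar>" and G = "\<lambda>x. cos (k * x)" and g = "\<lambda>x. - k * sin (k * x)"])
        (auto intro!: derivative_eq_intros continuous_intros mult_left_le simp: abs_mult)
    also have "(\<lambda>s. parity s \<omega> * (- k * sin (k * travel s \<omega>))) = (\<lambda>s. - k * ?f s \<omega>)"
      by (simp add: fun_eq_iff)
    also have "(LINT s:{0..t}|lborel. - k * ?f s \<omega>) = - k * (LINT s:{0..t}|lborel. ?f s \<omega>)"
      by (rule set_integral_mult_right)
    finally show ?thesis
      by simp
  qed
  then have "mean_cos k t = expectation (\<lambda>\<omega>. 1 - k * (LINT s:{0..t}|lborel. ?f s \<omega>))"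
    unfolding mean_cos_def by (intro Bochner_Integration.integral_cong refl)
  also have "\<dots> = 1 - k * expectation (\<lambda>\<omega>. LINT s:{0..t}|lborel. ?f s \<omega>)"
  proof -
    have "integrable M (\<lambda>\<omega>. 1 - cos (k * travel t \<omega>))"
      by (intro Bochner_Integration.integrable_diff integrable_const integrable_const_bound [where B = 1]) auto
    then have "integrable M (\<lambda>\<omega>. k * (LINT s:{0..t}|lborel. ?f s \<omega>))"
      by (rule Bochner_Integration.integrable_cong [THEN iffD1, OF refl, rotated])
        (use \<open>\<And>\<omega>. \<omega> \<in> space M \<Longrightarrow> cos (k * travel t \<omega>) = 1 - k * (LINT s:{0..t}|lborel. ?f s \<omega>)\<close> in simp)
    then show ?thesis
      by (subst Bochner_Integration.integral_diff) (auto simp: prob_space)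
  qed
  also have "expectation (\<lambda>\<omega>. LINT s:{0..t}|lborel. ?f s \<omega>) = (LINT s:{0..t}|lborel. mean_parity_sin k s)"
    unfolding mean_parity_sin_def by (rule expectation_set_integral [OF meas bound])
  also have "\<dots> = integral {0..t} (mean_parity_sin k)"
    by (rule set_borel_integral_eq_integral(2) [OF int])
  finally show "mean_cos k t = 1 - k * integral {0..t} (mean_parity_sin k)" .
qed

lemma continuous_on_mean_cos: "continuous_on {0..T} (mean_cos k)"
proof (cases "T \<ge> 0")
  case True
  have "continuous_on {0..T} (\<lambda>t. 1 - k * integral {0..t} (mean_parity_sin k))"
    by (intro continuous_intros indefinite_integral_continuous_1 mean_cos_eq(2) True)
  then show ?thesis
    by (rule continuous_on_eq) (simp add: mean_cos_eq(1))
qed simp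

text \<open>Expanding \<open>sin (k * travel t \<omega>)\<close> by the chain rule leaves the product of the parities at
  times \<open>t\<close> and \<open>s\<close>, which is independent of the path up to time \<open>s\<close>.\<close>

lemma mean_parity_sin_eq:
  assumes "t \<ge> 0"
  shows "mean_parity_sin k t = k * exp (- 2 * a * t) * integral {0..t} (\<lambda>s. exp (2 * a * s) * mean_cos k s)"
proof -
  let ?f = "\<lambda>s \<omega>. parity t \<omega> * parity s \<omega> * cos (k * travel s \<omega>)"
  have bound: "\<bar>?f s \<omega>\<bar> \<le> 1" for s \<omega>
    by (simp add: abs_mult)
  have meas: "(\<lambda>z. ?f (fst z) (snd z)) \<in> borel_measurable (borel \<Otimes>\<^sub>M M)"
    by measurable
  have "parity t \<omega> * sin (k * travel t \<omega>) = k * (LINT s:{0..t}|lborel. ?f s \<omega>)" if "\<omega> \<in> space M" for \<omega>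
  proof -
    have "(LINT s:{0..t}|lborel. parity s \<omega> * (k * cos (k * travel s \<omega>))) = sin (k * travel t \<omega>) - sin (k * 0)"
      by (rule travel_FTC [OF that assms, where C = "\<bar>k\<bar>" and G = "\<lambda>x. sin (k * x)" and g = "\<lambda>x. k * cos (k * x)"])
        (auto intro!: derivative_eq_intros continuous_intros mult_left_le simp: abs_mult)
    then have "parity t \<omega> * sin (k * travel t \<omega>) = (LINT s:{0..t}|lborel. parity t \<omega> * (parity s \<omega> * (k * cos (k * travel s \<omega>))))"
      by simp
    also have "(\<lambda>s. parity t \<omega> * (parity s \<omega> * (k * cos (k * travel s \<omega>)))) = (\<lambda>s. k * ?f s \<omega>)"
      by (simp add: fun_eq_iff)
    finally show ?thesis
      by simp
  qed
  then have "mean_parity_sin k t = expectation (\<lambda>\<omega>. k * (LINT s:{0..t}|lborel. ?f s \<omega>))"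
    unfolding mean_parity_sin_def by (intro Bochner_Integration.integral_cong refl)
  also have "\<dots> = k * (LINT s:{0..t}|lborel. expectation (?f s))"
    by (simp only: integral_mult_right_zero expectation_set_integral [OF meas bound])
  also have "(LINT s:{0..t}|lborel. expectation (?f s)) =
      (LINT s:{0..t}|lborel. exp (- 2 * a * (t - s)) * mean_cos k s)"
    unfolding set_lebesgue_integral_def
  proof (rule integral_cong_AE)
    \<comment> \<open>The factorization of the expectation is available for \<open>0 < s\<close> and
      \<open>s < t\<close>; the endpoints are a null set.\<close>
    have "AE s in lborel. s \<notin> {0, t}"
      by (intro AE_not_in finite_imp_null_set_lborel) auto
    then show "AE s in lborel. indicator {0..t} s *\<^sub>R expectation (?f s) =
        indicator {0..t} s *\<^sub>R (exp (- 2 * a * (t - s)) * mean_cos k s)"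
    proof eventually_elim
      case (elim s)
      show ?case
      proof (cases "0 < s \<and> s < t")
        case True
        then have "expectation (?f s) = exp (- 2 * a * (t - s)) * mean_cos k s"
          unfolding mean_cos_def
          by (intro expectation_parity_mult_travel [where C = 1] continuous_intros) auto
        then show ?thesis
          by simp
      next
        case False
        with elim have "s \<notin> {0..t}"
          by auto
        then show ?thesis
          by simp
      qed
    qed
    show "(\<lambda>s. indicator {0..t} s *\<^sub>R expectation (?f s)) \<in> borel_measurable lborel"
      using set_integrable_expectation [OF meas bound, of t] by (simp add: set_integrable_def)
    have "set_integrable lborel {0..t} (\<lambda>s. exp (- 2 * a * (t - s)) * mean_cos k s)"
      by (intro borel_integrable_atLeastAtMost' continuous_intros continuous_on_mean_cos)
    then show "(\<lambda>s. indicator {0..t} s *\<^sub>R (exp (- 2 * a * (t - s)) * mean_cos k s)) \<in> borel_measurable lborel"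
      by (simp add: set_integrable_def)
  qed
  also have "\<dots> = integral {0..t} (\<lambda>s. exp (- 2 * a * (t - s)) * mean_cos k s)"
    by (intro set_borel_integral_eq_integral borel_integrable_atLeastAtMost' continuous_intros continuous_on_mean_cos)
  \<comment> \<open>Splitting the exponential frees the integrand of \<open>t\<close>, so that the
    product rule applies later.\<close>
  also have "\<dots> = integral {0..t} (\<lambda>s. exp (- 2 * a * t) * (exp (2 * a * s) * mean_cos k s))"
  proof -
    have "exp (- 2 * a * (t - s)) = exp (- 2 * a * t) * exp (2 * a * s)" for s
      by (simp add: exp_add [symmetric] algebra_simps)
    then show ?thesis
      by (simp only: mult.assoc)
  qed
  also have "\<dots> = exp (- 2 * a * t) * integral {0..t} (\<lambda>s. exp (2 * a * s) * mean_cos k s)"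
    by (rule integral_mult_right)
  finally show ?thesis
    by simp
qed

lemma
  assumes "t \<ge> 0"
  shows mean_cos_derivative: "(mean_cos k has_real_derivative - k * mean_parity_sin k t) (at t within {0..})"
    and mean_parity_sin_derivative:
      "(mean_parity_sin k has_real_derivative k * mean_cos k t - 2 * a * mean_parity_sin k t) (at t within {0..})"
proof -
  let ?T = "{0..t + 1}"
  \<comment> \<open>The derivative of an indefinite integral is taken on a bounded interval;
    extending it to \<open>t + 1\<close> leaves the one-sided notion at 0 and the ordinary one at
    \<open>t > 0\<close> unchanged.\<close>
  have within: "at t within ?T = at t within {0..}"
    by (rule at_within_nhd [of _ "{..<t + 1}"]) auto
  have t: "t \<in> ?T"
    using assms by simp
  let ?h = "\<lambda>s. exp (2 * a * s) * mean_cos k s"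
  have h: "continuous_on ?T ?h"
    by (intro continuous_intros continuous_on_mean_cos)
  have S: "((\<lambda>t. k * exp (- 2 * a * t) * integral {0..t} ?h) has_real_derivative
      k * (exp (- 2 * a * s) * - 2 * a) * integral {0..s} ?h + k * exp (- 2 * a * s) * ?h s) (at s within ?T)"
    if "s \<in> ?T" for s
    by (rule derivative_eq_intros integral_has_real_derivative [OF h that] refl)+ (simp add: algebra_simps)
  have "k * exp (- 2 * a * t) * ?h t = k * (exp (- 2 * a * t) * exp (2 * a * t)) * mean_cos k t"
    by (simp only: ac_simps)
  also have "exp (- 2 * a * t) * exp (2 * a * t) = 1"
    by (simp flip: exp_add)
  finally have h_t: "k * exp (- 2 * a * t) * ?h t = k * mean_cos k t"
    by simp
  have "((\<lambda>t. k * exp (- 2 * a * t) * integral {0..t} ?h) has_real_derivative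
      k * mean_cos k t - 2 * a * mean_parity_sin k t) (at t within ?T)"
    using S [OF t] unfolding h_t mean_parity_sin_eq [OF assms] by (rule DERIV_cong) simp
  then have "(mean_parity_sin k has_real_derivative k * mean_cos k t - 2 * a * mean_parity_sin k t) (at t within ?T)"
    unfolding has_field_derivative_def
    by (rule has_derivative_transform [OF t, rotated]) (simp add: mean_parity_sin_eq)
  then show "(mean_parity_sin k has_real_derivative k * mean_cos k t - 2 * a * mean_parity_sin k t) (at t within {0..})"
    unfolding within .
  have "continuous_on ?T (\<lambda>t. k * exp (- 2 * a * t) * integral {0..t} ?h)"
    using S by (rule DERIV_continuous_on)
  then have "continuous_on ?T (mean_parity_sin k)"
    by (rule continuous_on_eq) (simp add: mean_parity_sin_eq)
  from integral_has_real_derivative [OF this t]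
  have "((\<lambda>t. 1 - k * integral {0..t} (mean_parity_sin k)) has_real_derivative - k * mean_parity_sin k t) (at t within ?T)"
    by (auto intro!: derivative_eq_intros)
  then have "(mean_cos k has_real_derivative - k * mean_parity_sin k t) (at t within ?T)"
    unfolding has_field_derivative_def
    by (rule has_derivative_transform [OF t, rotated]) (simp add: mean_cos_eq(1))
  then show "(mean_cos k has_real_derivative - k * mean_parity_sin k t) (at t within {0..})"
    unfolding within .
qed

text \<open>\<open>travel\<close> has unit speed; the frequency \<open>k * c\<close> and the factor
  \<open>c\<close> on the sine expectation turn its system into the one with speed \<open>c\<close>.
  Both solutions start from 1 and 0.\<close>

lemma mean_cos_eq_kac_mean:
  assumes "c > 0" "t \<ge> 0"
  shows "mean_cos (k * c) t = kac_mean (a / c) c (\<lambda>t x. cos (k * x)) t"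
proof (rule telegraph_unique [where A = "mean_cos (k * c)" and D = "\<lambda>t. c * mean_parity_sin (k * c) t"
      and A' = "kac_mean (a / c) c (\<lambda>t x. cos (k * x))" and D' = "kac_flux (a / c) c (\<lambda>t x. sin (k * x))"
      and t = t and k = k and a = a and c = c])
  fix t :: real
  assume t: "t \<ge> 0"
  show "(mean_cos (k * c) has_real_derivative - k * (c * mean_parity_sin (k * c) t)) (at t within {0..})"
    using mean_cos_derivative [OF t, of "k * c"] by (simp add: mult.assoc)
  show "((\<lambda>t. c * mean_parity_sin (k * c) t) has_real_derivative
      c\<^sup>2 * k * mean_cos (k * c) t - 2 * a * (c * mean_parity_sin (k * c) t)) (at t within {0..})"
    by (rule DERIV_cong [OF DERIV_cmult [OF mean_parity_sin_derivative [OF t, of "k * c"]]])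
      (simp add: algebra_simps power2_eq_square)
  show "(kac_mean (a / c) c (\<lambda>t x. cos (k * x)) has_real_derivative
      - k * kac_flux (a / c) c (\<lambda>t x. sin (k * x)) t) (at t within {0..})"
    by (rule has_field_derivative_at_within [OF telegraph_cos(1)])
  show "(kac_flux (a / c) c (\<lambda>t x. sin (k * x)) has_real_derivative
      c\<^sup>2 * k * kac_mean (a / c) c (\<lambda>t x. cos (k * x)) t - 2 * a * kac_flux (a / c) c (\<lambda>t x. sin (k * x)) t)
      (at t within {0..})"
    using has_field_derivative_at_within [OF telegraph_cos(2) [of "a / c" c k t]] \<open>c > 0\<close> by simp
next
  show "mean_cos (k * c) 0 = kac_mean (a / c) c (\<lambda>t x. cos (k * x)) 0"
    by (subst mean_cos_eq(1)) (simp_all add: kac_mean_def)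
  show "c * mean_parity_sin (k * c) 0 = kac_flux (a / c) c (\<lambda>t x. sin (k * x)) 0"
    by (subst mean_parity_sin_eq) (simp_all add: kac_flux_def)
qed (use assms rate_pos in simp_all)

end

section \<open>Identification of the law of the process\<close>

lemma poisson_process_imp_poisson_paths:
  assumes "a > 0" "poisson_process M a N"
  shows "poisson_paths M N a"
proof -
  note pp = assms(2) [unfolded poisson_process_def]
  note count = pp [THEN conjunct2, THEN conjunct1]
  note paths = pp [THEN conjunct2, THEN conjunct2, THEN conjunct1]
  note distr = pp [THEN conjunct2, THEN conjunct2, THEN conjunct2, THEN conjunct1]
  note indep = pp [THEN conjunct2, THEN conjunct2, THEN conjunct2, THEN conjunct2]
  interpret prob_space M
    using pp by (rule conjunct1)
  show ?thesis
  proof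
    show "N t \<in> M \<rightarrow>\<^sub>M count_space UNIV" if "t \<ge> 0" for t
      using count that by simp
    fix \<omega> assume \<omega>: "\<omega> \<in> space M"
    show "N 0 \<omega> = 0" "mono_on {0..} (\<lambda>t. N t \<omega>)"
      using bspec [OF paths \<omega>] by simp_all
    show "continuous (at_right t) (\<lambda>s. N s \<omega>)" if "t \<ge> 0" for t
      using bspec [OF paths \<omega>] that by simp
  next
    show "a > 0"
      by fact
    show "distr M (count_space UNIV) (\<lambda>\<omega>. N t \<omega> - N s \<omega>) = measure_pmf (poisson_pmf (a * (t - s)))"
      if "0 \<le> s" "s < t" for s t
      using distr that by simp
    show "indep_vars (\<lambda>_. count_space UNIV) (\<lambda>i \<omega>. N (\<tau> (Suc i)) \<omega> - N (\<tau> i) \<omega>) {..<n}"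
      if "0 \<le> \<tau> 0" "\<And>i. i < n \<Longrightarrow> \<tau> i < \<tau> (Suc i)" for \<tau> :: "nat \<Rightarrow> real" and n
      by (rule indep [THEN spec [of _ n], THEN spec [of _ \<tau>], THEN mp]) (use that in blast)
  qed
qed

text \<open>By Levy uniqueness it suffices to compare characteristic functions. The cosine is even,
  so \<open>B\<close> drops out of the real part; the sine is odd, so the imaginary part carries a
  factor \<open>B\<close>, which is independent of the path and has mean 0.\<close>

lemma distr_kac_process:
  assumes "a > 0" "c > 0" and driver: "kac_driver M a N B" and "t \<ge> 0"
  shows "kac_process c N B t \<in> borel_measurable M"
    and "distr M borel (kac_process c N B t) = kac_law a c t"
proof -
  have pp: "poisson_process M a N" and B [measurable]: "B \<in> borel_measurable M"
    and B_cases: "\<And>\<omega>. \<omega> \<in> space M \<Longrightarrow> B \<omega> = -1 \<or> B \<omega> = 1"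
    and B_prob: "measure M {\<omega> \<in> space M. B \<omega> = 1} = 1 / 2" "measure M {\<omega> \<in> space M. B \<omega> = -1} = 1 / 2"
    using driver unfolding kac_driver_def by simp_all
  interpret poisson_paths M N a
    using poisson_process_imp_poisson_paths [OF assms(1) pp] .
  let ?K = "kac_process c N B t"
  have K: "?K = (\<lambda>\<omega>. B \<omega> * c * travel t \<omega>)"
  proof
    fix \<omega>
    have "(LINT s:{0..t}|lborel. (-1) ^ N s \<omega>) = travel t \<omega>"
      unfolding travel_def by (rule set_lebesgue_integral_cong) (auto simp: parity_def max_absorb2)
    then show "?K \<omega> = B \<omega> * c * travel t \<omega>"
      by (simp add: kac_process_def)
  qed
  show K_meas [measurable]: "?K \<in> borel_measurable M"
    unfolding K by measurable
  show "distr M borel ?K = kac_law a c t"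
  proof (cases "t = 0")
    case True
    have "distr M borel ?K = distr M borel (\<lambda>\<omega>. 0)"
      by (intro distr_cong refl) (unfold K, simp add: True travel_0)
    also have "\<dots> = return borel 0"
      by (rule distr_const) simp
    finally show ?thesis
      by (simp add: True kac_law_0)
  next
    case False
    with \<open>t \<ge> 0\<close> have "t > 0"
      by simp
    \<comment> \<open>The sigma-algebra generated by the counting process. Interpreting
      \<open>counting_paths\<close> on it makes \<open>travel\<close> measurable with respect to
      \<open>?V\<close>, and the independence of \<open>B\<close> from \<open>?V\<close> passes to
      functions of \<open>travel\<close>.\<close>
    let ?V = "vimage_algebra (space M) (\<lambda>\<omega>. \<lambda>t\<in>{0..}. N t \<omega>) (PiM {0..} (\<lambda>_. count_space UNIV))"
    interpret V: counting_paths ?V N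
    proof
      fix t :: real
      assume "t \<ge> 0"
      have "(\<lambda>\<omega>. \<lambda>t\<in>{0..}. N t \<omega>) \<in> ?V \<rightarrow>\<^sub>M PiM {0..} (\<lambda>_. count_space UNIV)"
        by (rule measurable_vimage_algebra1) (auto simp: space_PiM)
      from measurable_compose [OF this measurable_component_singleton [of t]] \<open>t \<ge> 0\<close>
      show "N t \<in> ?V \<rightarrow>\<^sub>M count_space UNIV"
        by simp
    qed (use count_0 mono_count rcont_count in auto)
    have indep: "indep_var borel B borel (\<lambda>\<omega>. sin (k * travel t \<omega>))" for k
      unfolding indep_var_eq
    proof (intro conjI)
      let ?Y = "\<lambda>\<omega>. sin (k * travel t \<omega>)"
      show "random_variable borel B" "random_variable borel ?Y"
        by measurable
      have Y: "?Y \<in> borel_measurable ?V"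
        by measurable
      have "sigma_sets (space M) {?Y -` A \<inter> space M |A. A \<in> sets borel} \<subseteq> sets ?V"
        using measurable_sets [OF Y] by (intro sets.sigma_sets_subset [of _ ?V, simplified]) auto
      moreover have "indep_set (sigma_sets (space M) {B -` A \<inter> space M |A. A \<in> sets borel}) (sets ?V)"
        using driver unfolding kac_driver_def sets_vimage_algebra [of _ B] by (elim conjE)
      ultimately show "indep_set (sigma_sets (space M) {B -` A \<inter> space M |A. A \<in> sets borel})
          (sigma_sets (space M) {?Y -` A \<inter> space M |A. A \<in> sets borel})"
        unfolding indep_set_def by (elim indep_sets_mono_sets) (auto split: bool.split)
    qed
    have "norm (B \<omega>) \<le> 1" if "\<omega> \<in> space M" for \<omega>
      using B_cases [OF that] by auto
    then have int_B: "integrable M B"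
      by (intro integrable_const_bound [where B = 1] AE_I2 B)
    have exp_B: "expectation B = 0"
    proof -
      have "expectation B = expectation (\<lambda>\<omega>. indicator {\<omega> \<in> space M. B \<omega> = 1} \<omega> - indicator {\<omega> \<in> space M. B \<omega> = -1} \<omega>)"
      proof (intro Bochner_Integration.integral_cong refl)
        fix \<omega> assume "\<omega> \<in> space M"
        with B_cases [OF this]
        show "B \<omega> = indicator {\<omega> \<in> space M. B \<omega> = 1} \<omega> - indicator {\<omega> \<in> space M. B \<omega> = -1} \<omega>"
          by auto
      qed
      also have "\<dots> = 1 / 2 - 1 / 2"
        by (subst Bochner_Integration.integral_diff) (auto intro!: integrable_real_indicator simp: B_prob Int_absorb2 less_top [symmetric])
      finally show ?thesis
        by simp
    qed
    show ?thesis
    proof (rule Levy_uniqueness)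
      show "real_distribution (distr M borel ?K)"
        by (rule real_distribution_distr) simp
      interpret L: prob_space "kac_law a c t"
        by (rule prob_space_kac_law) fact+
      show "real_distribution (kac_law a c t)"
        by unfold_locales simp
      show "char (distr M borel ?K) = char (kac_law a c t)"
      proof
        fix k :: real
        have char: "char (distr M borel ?K) k = (CLINT \<omega>|M. iexp (k * ?K \<omega>))"
          unfolding char_def by (subst integral_distr) auto
        have int: "integrable M (\<lambda>\<omega>. iexp (k * ?K \<omega>))"
          by (rule integrable_const_bound [where B = 1]) auto
        have "Re (char (distr M borel ?K) k) = expectation (\<lambda>\<omega>. cos (k * ?K \<omega>))"
          unfolding char integral_Re [OF int, symmetric] by (simp add: Re_exp)
        also have "\<dots> = mean_cos (k * c) t"
          unfolding mean_cos_def
        proof (intro Bochner_Integration.integral_cong refl)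
          fix \<omega> assume "\<omega> \<in> space M"
          from B_cases [OF this] show "cos (k * ?K \<omega>) = cos (k * c * travel t \<omega>)"
            by (auto simp: K mult.assoc)
        qed
        also have "\<dots> = Re (char (kac_law a c t) k)"
          using assms \<open>t > 0\<close> by (simp add: char_kac_law mean_cos_eq_kac_mean)
        finally have Re: "Re (char (distr M borel ?K) k) = Re (char (kac_law a c t) k)" .
        have "Im (char (distr M borel ?K) k) = expectation (\<lambda>\<omega>. sin (k * ?K \<omega>))"
          unfolding char integral_Im [OF int, symmetric] by (simp add: Im_exp)
        also have "\<dots> = expectation (\<lambda>\<omega>. B \<omega> * sin (k * c * travel t \<omega>))"
        proof (intro Bochner_Integration.integral_cong refl)
          fix \<omega> assume "\<omega> \<in> space M"
          from B_cases [OF this] show "sin (k * ?K \<omega>) = B \<omega> * sin (k * c * travel t \<omega>)"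
            by (auto simp: K mult.assoc)
        qed
        also have "\<dots> = expectation B * expectation (\<lambda>\<omega>. sin (k * c * travel t \<omega>))"
          by (intro indep_var_lebesgue_integral indep int_B integrable_const_bound [where B = 1]) auto
        also have "\<dots> = Im (char (kac_law a c t) k)"
          using assms \<open>t > 0\<close> by (simp add: exp_B char_kac_law)
        finally show "char (distr M borel ?K) k = char (kac_law a c t) k"
          using Re by (simp add: complex_eq_iff)
      qed
    qed
  qed
qed

theorem theorem4p4:
  fixes a c :: real and v :: "real \<Rightarrow> real \<Rightarrow> real" and M :: "'w measure"
  assumes "a > 0" and "c > 0"
    and "kac_velocity a c v"
  shows "(\<forall>t>0. prob_space (kac_law a c t)) \<and>
    kac_law a c 0 = return borel 0 \<and>
    (\<forall>N B. kac_driver M a N B \<longrightarrow>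
       (\<forall>t\<ge>0. kac_process c N B t \<in> borel_measurable M \<and>
          distr M borel (kac_process c N B t) = kac_law a c t)) \<and>
    weak_continuity_solution (kac_law a c) v"
  using prob_space_kac_law [OF assms(1,2)] kac_law_0 [of a c] distr_kac_process [OF assms(1,2)]
    weak_continuity_solution_kac_law [OF assms] by (intro conjI allI impI)

end
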